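(* Let $\mathrm{S}$ be a complex $3$-dimensional semi-alternative algebra with nonzero multiplication. Then $\mathrm{S}$ is isomorphic to one of the associative algebras $\mathrm{A}_{01},\dots,\mathrm{A}_{24}$ listed in the context or to one of the following algebras (given in a basis $e_1,e_2,e_3$; all products of basis elements not listed are zero): $\mathrm{S}_{01}^{\alpha}$ ($\alpha\in\mathbb{C}$): $e_1e_1=e_2$, $e_1e_2=(\alpha+1)e_3$, $e_2e_1=(\alpha-1)e_3$; $\mathrm{S}_{02}$: $e_1e_1=2e_1+e_2$, $e_1e_2=2e_2$, $e_3e_1=2e_3$; $\mathrm{S}_{03}$: $e_1e_1=2e_1+e_2+e_3$, $e_1e_2=2e_2$, $e_3e_1=2e_3$; $\mathrm{S}_{04}$: $e_1e_1=2e_1+e_3$, $e_1e_2=2e_2$, $e_3e_1=2e_3$; $\mathrm{S}_{05}$: $e_1e_1=2e_1+e_2$, $e_2e_1=2e_2$, $e_1e_3=2e_3$, $e_3e_1=2e_3$; $\mathrm{S}_{06}$: $e_1e_1=2e_1+e_2$, $e_2e_1=2e_2$, $e_3e_3=e_3$; $\mathrm{S}_{07}$: $e_1e_1=2e_1+e_2$, $e_2e_1=2e_2$; $\mathrm{S}_{08}$: $e_1e_1=2e_1+e_2$, $e_1e_2=2e_2$, $e_1e_3=2e_3$, $e_3e_1=2e_3$; $\mathrm{S}_{09}$: $e_1e_1=2e_1+e_2$, $e_1e_2=2e_2$, $e_3e_3=e_3$; $\mathrm{S}_{10}$: $e_1e_1=2e_1+e_2$, $e_1e_2=2e_2$; $\mathrm{S}_{11}$: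 $e_1e_1=e_2+e_3$, $e_1e_2=e_2$, $e_2e_1=-e_2$, $e_1e_3=e_1$, $e_3e_1=e_1$, $e_2e_3=e_2$, $e_3e_2=e_2$, $e_3e_3=e_3$; $\mathrm{S}_{12}$: $e_1e_1=2e_1+e_2$, $e_1e_2=2e_2$, $e_1e_3=2e_3$; $\mathrm{S}_{13}$: $e_1e_1=2e_1+e_2$, $e_2e_1=2e_2$, $e_3e_1=2e_3$.
   Context: An algebra is a complex vector space with a bilinear (not necessarily associative) multiplication; the associator is $(x,y,z)=(xy)z-x(yz)$. An algebra is semi-alternative if $(x,y,z)=(y,z,x)$ for all $x,y,z$. The algebras below are given in a basis $e_1,e_2,e_3$. For $\mathrm{A}_{01},\dots,\mathrm{A}_{11}$ the multiplication is commutative, and products neither listed nor obtained from listed ones by commutativity are zero; for $\mathrm{A}_{12},\dots,\mathrm{A}_{24}$ all products not listed are zero. $\mathrm{A}_{01}$: $e_1e_1=e_1$, $e_2e_2=e_2$; $\mathrm{A}_{02}$: $e_1e_1=e_1$, $e_1e_2=e_2$; $\mathrm{A}_{03}$: $e_1e_1=e_1$; $\mathrm{A}_{04}$: $e_1e_1=e_2$; $\mathrm{A}_{05}$: $e_1e_2=e_3$; $\mathrm{A}_{06}$: $e_1e_1=e_2$, $e_1e_2=e_3$; $\mathrm{A}_{07}$: $e_1e_1=e_1$, $e_2e_2=e_2$, $e_3e_3=e_3$; $\mathrm{A}_{08}$: $e_1e_1=e_1$, $e_2e_2=e_2$, $e_2e_3=e_3$; $\mathrm{A}_{09}$: $e_1e_1=e_1$,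 $e_1e_2=e_2$, $e_1e_3=e_3$; $\mathrm{A}_{10}$: $e_1e_1=e_1$, $e_1e_2=e_2$, $e_1e_3=e_3$, $e_2e_2=e_3$; $\mathrm{A}_{11}$: $e_1e_1=e_1$, $e_2e_2=e_3$; $\mathrm{A}_{12}$: $e_1e_2=e_3$, $e_2e_1=-e_3$; $\mathrm{A}_{13}$: $e_1e_1=e_2$, $e_1e_3=e_2$, $e_3e_1=-e_2$; $\mathrm{A}_{14}^{\alpha}$ ($\alpha\in\mathbb{C}$, $\alpha\neq0$): $e_1e_2=(1+\alpha)e_3$, $e_2e_1=(1-\alpha)e_3$; $\mathrm{A}_{15}$: $e_1e_1=e_1$, $e_1e_2=e_2$, $e_1e_3=e_3$, $e_3e_1=e_3$; $\mathrm{A}_{16}$: $e_1e_1=e_1$, $e_1e_3=e_3$, $e_2e_1=e_2$, $e_3e_1=e_3$; $\mathrm{A}_{17}$: $e_1e_1=e_1$, $e_1e_2=e_2$, $e_1e_3=e_3$; $\mathrm{A}_{18}$: $e_1e_1=e_1$, $e_2e_1=e_2$, $e_3e_1=e_3$; $\mathrm{A}_{19}$: $e_1e_1=e_1$, $e_1e_3=e_3$, $e_2e_1=e_2$; $\mathrm{A}_{20}$: $e_1e_1=e_1$, $e_1e_3=e_3$, $e_2e_2=e_2$, $e_3e_2=e_3$; $\mathrm{A}_{21}$: $e_1e_1=e_1$, $e_2e_1=e_2$; $\mathrm{A}_{22}$: $e_1e_1=e_1$, $e_1e_2=e_2$; $\mathrm{A}_{23}$: $e_1e_1=e_1$, $e_1e_3=e_3$,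 $e_2e_2=e_2$; $\mathrm{A}_{24}$: $e_1e_1=e_1$, $e_2e_2=e_2$, $e_3e_1=e_3$. *)

theory Defs
  imports "HOL-Analysis.Analysis"
begin

section \<open>Nonassociative algebras over the complex numbers\<close>

locale complex_algebra = vector_space scale
  for scale :: "complex \<Rightarrow> 'a::ab_group_add \<Rightarrow> 'a" +
  fixes mul :: "'a \<Rightarrow> 'a \<Rightarrow> 'a"
  assumes linear_mul_right: "Vector_Spaces.linear scale scale (\<lambda>y. mul x y)"
    and linear_mul_left: "Vector_Spaces.linear scale scale (\<lambda>x. mul x y)"

definition associator :: "('a::ab_group_add \<Rightarrow> 'a \<Rightarrow> 'a) \<Rightarrow> 'a \<Rightarrow> 'a \<Rightarrow> 'a \<Rightarrow> 'a" where
  "associator mul x y z = mul (mul x y) z - mul x (mul y z)"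

locale semi_alternative_algebra = complex_algebra +
  assumes semi_alternative: "associator mul x y z = associator mul y z x"

definition algebra_isomorphic ::
  "(complex \<Rightarrow> 'a::ab_group_add \<Rightarrow> 'a) \<Rightarrow> ('a \<Rightarrow> 'a \<Rightarrow> 'a) \<Rightarrow>
   (complex \<Rightarrow> 'b::ab_group_add \<Rightarrow> 'b) \<Rightarrow> ('b \<Rightarrow> 'b \<Rightarrow> 'b) \<Rightarrow> bool" where
  "algebra_isomorphic scale1 mul1 scale2 mul2 \<longleftrightarrow>
     (\<exists>f. Vector_Spaces.linear scale1 scale2 f \<and> bij f \<and>
          (\<forall>x y. f (mul1 x y) = mul2 (f x) (f y)))"

section \<open>Algebras given by a multiplication table\<close>

abbreviation e1 :: "complex^3" where "e1 \<equiv> axis 1 1"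
abbreviation e2 :: "complex^3" where "e2 \<equiv> axis 2 1"
abbreviation e3 :: "complex^3" where "e3 \<equiv> axis 3 1"

type_synonym mult_table = "((3 \<times> 3) \<times> (complex^3)) list"

text \<open>
  An entry \<open>((i,j), v)\<close> of a table says that the product of the \<open>i\<close>-th and the \<open>j\<close>-th basis
  vector is \<open>v\<close>; products of basis vectors that are not listed are zero. The index type \<open>3\<close> has
  exactly the three elements \<open>1\<close>, \<open>2\<close> and \<open>3\<close> (the last one equals \<open>0\<close>).
\<close>

definition basis_product :: "mult_table \<Rightarrow> 3 \<Rightarrow> 3 \<Rightarrow> complex^3" where
  "basis_product t i j = (case map_of t (i, j) of Some v \<Rightarrow> v | None \<Rightarrow> 0)"

definition table_mult :: "mult_table \<Rightarrow> complex^3 \<Rightarrow> complex^3 \<Rightarrow> complex^3" where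
  "table_mult t x y = (\<Sum>i\<in>UNIV. \<Sum>j\<in>UNIV. (x $ i * y $ j) *s basis_product t i j)"

definition comm_table_mult :: "mult_table \<Rightarrow> complex^3 \<Rightarrow> complex^3 \<Rightarrow> complex^3" where
  "comm_table_mult t = table_mult (t @ map (\<lambda>((i, j), v). ((j, i), v)) t)"

lemma table_mult_axis: "table_mult t (axis i 1) (axis j 1) = basis_product t i j"
proof -
  have "(axis i 1 $ k * axis j 1 $ l) *s basis_product t k l =
      (if l = j then if k = i then basis_product t i j else 0 else 0)" for k l
    by (simp add: axis_def)
  then show ?thesis
    by (simp add: table_mult_def)
qed

lemma complex_algebra_table_mult: "complex_algebra vector_scalar_mult (table_mult t)"
proof (intro complex_algebra.intro complex_algebra_axioms.intro vec.vector_space_axioms)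
  fix x show "Vector_Spaces.linear vector_scalar_mult vector_scalar_mult (\<lambda>y. table_mult t x y)"
    by unfold_locales
      (simp_all add: table_mult_def vec_eq_iff sum.distrib sum_distrib_left algebra_simps)
next
  fix y show "Vector_Spaces.linear vector_scalar_mult vector_scalar_mult (\<lambda>x. table_mult t x y)"
    by unfold_locales
      (simp_all add: table_mult_def vec_eq_iff sum.distrib sum_distrib_left algebra_simps)
qed

section \<open>The algebras of the classification\<close>

definition A01 :: "complex^3 \<Rightarrow> complex^3 \<Rightarrow> complex^3" where
  "A01 = comm_table_mult [((1,1), e1), ((2,2), e2)]"

definition A02 :: "complex^3 \<Rightarrow> complex^3 \<Rightarrow> complex^3" where
  "A02 = comm_table_mult [((1,1), e1), ((1,2), e2)]"

definition A03 :: "complex^3 \<Rightarrow> complex^3 \<Rightarrow> complex^3" where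
  "A03 = comm_table_mult [((1,1), e1)]"

definition A04 :: "complex^3 \<Rightarrow> complex^3 \<Rightarrow> complex^3" where
  "A04 = comm_table_mult [((1,1), e2)]"

definition A05 :: "complex^3 \<Rightarrow> complex^3 \<Rightarrow> complex^3" where
  "A05 = comm_table_mult [((1,2), e3)]"

definition A06 :: "complex^3 \<Rightarrow> complex^3 \<Rightarrow> complex^3" where
  "A06 = comm_table_mult [((1,1), e2), ((1,2), e3)]"

definition A07 :: "complex^3 \<Rightarrow> complex^3 \<Rightarrow> complex^3" where
  "A07 = comm_table_mult [((1,1), e1), ((2,2), e2), ((3,3), e3)]"

definition A08 :: "complex^3 \<Rightarrow> complex^3 \<Rightarrow> complex^3" where
  "A08 = comm_table_mult [((1,1), e1), ((2,2), e2), ((2,3), e3)]"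

definition A09 :: "complex^3 \<Rightarrow> complex^3 \<Rightarrow> complex^3" where
  "A09 = comm_table_mult [((1,1), e1), ((1,2), e2), ((1,3), e3)]"

definition A10 :: "complex^3 \<Rightarrow> complex^3 \<Rightarrow> complex^3" where
  "A10 = comm_table_mult [((1,1), e1), ((1,2), e2), ((1,3), e3), ((2,2), e3)]"

definition A11 :: "complex^3 \<Rightarrow> complex^3 \<Rightarrow> complex^3" where
  "A11 = comm_table_mult [((1,1), e1), ((2,2), e3)]"

definition A12 :: "complex^3 \<Rightarrow> complex^3 \<Rightarrow> complex^3" where
  "A12 = table_mult [((1,2), e3), ((2,1), - e3)]"

definition A13 :: "complex^3 \<Rightarrow> complex^3 \<Rightarrow> complex^3" where
  "A13 = table_mult [((1,1), e2), ((1,3), e2), ((3,1), - e2)]"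

definition A14 :: "complex \<Rightarrow> complex^3 \<Rightarrow> complex^3 \<Rightarrow> complex^3" where
  "A14 \<alpha> = table_mult [((1,2), (1 + \<alpha>) *s e3), ((2,1), (1 - \<alpha>) *s e3)]"

definition A15 :: "complex^3 \<Rightarrow> complex^3 \<Rightarrow> complex^3" where
  "A15 = table_mult [((1,1), e1), ((1,2), e2), ((1,3), e3), ((3,1), e3)]"

definition A16 :: "complex^3 \<Rightarrow> complex^3 \<Rightarrow> complex^3" where
  "A16 = table_mult [((1,1), e1), ((1,3), e3), ((2,1), e2), ((3,1), e3)]"

definition A17 :: "complex^3 \<Rightarrow> complex^3 \<Rightarrow> complex^3" where
  "A17 = table_mult [((1,1), e1), ((1,2), e2), ((1,3), e3)]"

definition A18 :: "complex^3 \<Rightarrow> complex^3 \<Rightarrow> complex^3" where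
  "A18 = table_mult [((1,1), e1), ((2,1), e2), ((3,1), e3)]"

definition A19 :: "complex^3 \<Rightarrow> complex^3 \<Rightarrow> complex^3" where
  "A19 = table_mult [((1,1), e1), ((1,3), e3), ((2,1), e2)]"

definition A20 :: "complex^3 \<Rightarrow> complex^3 \<Rightarrow> complex^3" where
  "A20 = table_mult [((1,1), e1), ((1,3), e3), ((2,2), e2), ((3,2), e3)]"

definition A21 :: "complex^3 \<Rightarrow> complex^3 \<Rightarrow> complex^3" where
  "A21 = table_mult [((1,1), e1), ((2,1), e2)]"

definition A22 :: "complex^3 \<Rightarrow> complex^3 \<Rightarrow> complex^3" where
  "A22 = table_mult [((1,1), e1), ((1,2), e2)]"

definition A23 :: "complex^3 \<Rightarrow> complex^3 \<Rightarrow> complex^3" where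
  "A23 = table_mult [((1,1), e1), ((1,3), e3), ((2,2), e2)]"

definition A24 :: "complex^3 \<Rightarrow> complex^3 \<Rightarrow> complex^3" where
  "A24 = table_mult [((1,1), e1), ((2,2), e2), ((3,1), e3)]"

definition S01 :: "complex \<Rightarrow> complex^3 \<Rightarrow> complex^3 \<Rightarrow> complex^3" where
  "S01 \<alpha> = table_mult [((1,1), e2), ((1,2), (\<alpha> + 1) *s e3), ((2,1), (\<alpha> - 1) *s e3)]"

definition S02 :: "complex^3 \<Rightarrow> complex^3 \<Rightarrow> complex^3" where
  "S02 = table_mult [((1,1), 2 *s e1 + e2), ((1,2), 2 *s e2), ((3,1), 2 *s e3)]"

definition S03 :: "complex^3 \<Rightarrow> complex^3 \<Rightarrow> complex^3" where
  "S03 = table_mult [((1,1), 2 *s e1 + e2 + e3), ((1,2), 2 *s e2), ((3,1), 2 *s e3)]"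

definition S04 :: "complex^3 \<Rightarrow> complex^3 \<Rightarrow> complex^3" where
  "S04 = table_mult [((1,1), 2 *s e1 + e3), ((1,2), 2 *s e2), ((3,1), 2 *s e3)]"

definition S05 :: "complex^3 \<Rightarrow> complex^3 \<Rightarrow> complex^3" where
  "S05 = table_mult [((1,1), 2 *s e1 + e2), ((2,1), 2 *s e2), ((1,3), 2 *s e3), ((3,1), 2 *s e3)]"

definition S06 :: "complex^3 \<Rightarrow> complex^3 \<Rightarrow> complex^3" where
  "S06 = table_mult [((1,1), 2 *s e1 + e2), ((2,1), 2 *s e2), ((3,3), e3)]"

definition S07 :: "complex^3 \<Rightarrow> complex^3 \<Rightarrow> complex^3" where
  "S07 = table_mult [((1,1), 2 *s e1 + e2), ((2,1), 2 *s e2)]"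

definition S08 :: "complex^3 \<Rightarrow> complex^3 \<Rightarrow> complex^3" where
  "S08 = table_mult [((1,1), 2 *s e1 + e2), ((1,2), 2 *s e2), ((1,3), 2 *s e3), ((3,1), 2 *s e3)]"

definition S09 :: "complex^3 \<Rightarrow> complex^3 \<Rightarrow> complex^3" where
  "S09 = table_mult [((1,1), 2 *s e1 + e2), ((1,2), 2 *s e2), ((3,3), e3)]"

definition S10 :: "complex^3 \<Rightarrow> complex^3 \<Rightarrow> complex^3" where
  "S10 = table_mult [((1,1), 2 *s e1 + e2), ((1,2), 2 *s e2)]"

definition S11 :: "complex^3 \<Rightarrow> complex^3 \<Rightarrow> complex^3" where
  "S11 = table_mult [((1,1), e2 + e3), ((1,2), e2), ((2,1), - e2), ((1,3), e1), ((3,1), e1),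
     ((2,3), e2), ((3,2), e2), ((3,3), e3)]"

definition S12 :: "complex^3 \<Rightarrow> complex^3 \<Rightarrow> complex^3" where
  "S12 = table_mult [((1,1), 2 *s e1 + e2), ((1,2), 2 *s e2), ((1,3), 2 *s e3)]"

definition S13 :: "complex^3 \<Rightarrow> complex^3 \<Rightarrow> complex^3" where
  "S13 = table_mult [((1,1), 2 *s e1 + e2), ((2,1), 2 *s e2), ((3,1), 2 *s e3)]"

lemmas table_mult_simps = associator_def comm_table_mult_def table_mult_def basis_product_def
  axis_def vec_eq_iff forall_3 sum_3

lemma associative_A:
  assumes "M \<in> {A01, A02, A03, A04, A05, A06, A07, A08, A09, A10, A11, A12, A13, A15, A16,
                  A17, A18, A19, A20, A21, A22, A23, A24}"
  shows "associator M x y z = 0"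
  using assms
  by (elim insertE emptyE)
    (simp_all add: table_mult_simps algebra_simps
      A01_def A02_def A03_def A04_def A05_def A06_def A07_def A08_def A09_def
      A10_def A11_def A12_def A13_def A15_def A16_def A17_def A18_def A19_def
      A20_def A21_def A22_def A23_def A24_def)

lemma associative_A14: "associator (A14 \<alpha>) x y z = 0"
  by (simp add: A14_def table_mult_simps algebra_simps)

lemma semi_alternative_S01: "associator (S01 \<alpha>) x y z = associator (S01 \<alpha>) y z x"
  by (simp add: S01_def table_mult_simps algebra_simps)

lemma semi_alternative_S:
  assumes "M \<in> {S02, S03, S04, S05, S06, S07, S08, S09, S10, S11, S12, S13}"
  shows "associator M x y z = associator M y z x"
  using assms
  by (elim insertE emptyE)
    (simp_all add: table_mult_simps algebra_simps
      S02_def S03_def S04_def S05_def S06_def S07_def S08_def S09_def S10_def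
      S11_def S12_def S13_def)

end

(*
  For the operators L x and R x of left and right multiplication, semi-alternativity reads
  L (xy) = L x L y + [R x, L y].  Hence lam x = trace (L x) satisfies lam (xy) = trace (L x L y),
  vanishes on associators, and lam ((x,y,z) w) is alternating in four arguments, so it is zero in
  dimension three.  If lam is not zero, then likewise lam ([x,y] z) = 0, the transposed operators
  commute on the functionals lam (w -), and a common eigenvector of them is a multiple of a
  character, i.e. a nonzero multiplicative linear functional.  The same applies to trace (R x) by
  passing to the opposite algebra.  If both traces vanish, all L x and R x are nilpotent, and the
  algebra is described by hand.

  If there is a character, let K be its kernel, a two-dimensional ideal, to which the dichotomy is
  applied again: K has zero multiplication (L e and R e are commuting idempotents on K for
  e outside K of character value 1), or K is spanned by f and f^2, or K has a character, and then
  the kernel of the latter turns out to be an ideal of the whole algebra.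
*)

theory Submission
  imports Defs "HOL-Computational_Algebra.Fundamental_Theorem_Algebra"
begin

section \<open>Bilinear multiplications and isomorphisms\<close>

text \<open>So a functional is sought instead of an element, and any \<open>e\<close> of value 1
  plays the part of the idempotent, with \<open>e e = e + n\<close> for some \<open>n\<close> in the
  kernel. The part of \<open>n\<close> that cannot be absorbed into \<open>e\<close> is what
  separates many of the S-algebras from associative ones; their factors 2 arise from replacing
  \<open>e\<close> by \<open>2 e\<close>. Dimension three enters the search for the functional
  through alternating forms: one in four arguments vanishes, and a nonzero one in three arguments is
  a volume form. The kernel is never handled as a two-dimensional algebra. Its product is extended
  to the whole space by letting \<open>e\<close> multiply to zero, so that the dichotomy applies to
  it verbatim. Tables with many unknown coefficients are cut down by transporting semi-alternativity
  to them, where it becomes a system of polynomial equations.\<close>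

context complex_algebra
begin

lemma mul_add_right: "mul x (y + z) = mul x y + mul x z"
  and mul_scale_right: "mul x (scale c y) = scale c (mul x y)"
  and mul_diff_right: "mul x (y - z) = mul x y - mul x z"
  and mul_minus_right: "mul x (- y) = - mul x y"
  and mul_zero_right: "mul x 0 = 0"
proof -
  interpret r: Vector_Spaces.linear scale scale "mul x" by (rule linear_mul_right)
  show "mul x (y + z) = mul x y + mul x z" "mul x (scale c y) = scale c (mul x y)"
    "mul x (y - z) = mul x y - mul x z" "mul x (- y) = - mul x y" "mul x 0 = 0"
    by (simp_all add: r.add r.scale r.diff r.neg r.zero)
qed

lemma mul_add_left: "mul (y + z) x = mul y x + mul z x"
  and mul_scale_left: "mul (scale c y) x = scale c (mul y x)"
  and mul_diff_left: "mul (y - z) x = mul y x - mul z x"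
  and mul_minus_left: "mul (- y) x = - mul y x"
  and mul_zero_left: "mul 0 x = 0"
proof -
  interpret r: Vector_Spaces.linear scale scale "\<lambda>y. mul y x" by (rule linear_mul_left)
  show "mul (y + z) x = mul y x + mul z x" "mul (scale c y) x = scale c (mul y x)"
    "mul (y - z) x = mul y x - mul z x" "mul (- y) x = - mul y x" "mul 0 x = 0"
    by (simp_all add: r.add r.scale r.diff r.neg r.zero)
qed

lemmas mul_simps = mul_add_right mul_scale_right mul_diff_right mul_minus_right mul_zero_right
  mul_add_left mul_scale_left mul_diff_left mul_minus_left mul_zero_left

lemma complex_algebra_opposite: "complex_algebra scale (\<lambda>x y. mul y x)"
  by (intro complex_algebra.intro complex_algebra_axioms.intro vector_space_axioms
      linear_mul_left linear_mul_right)

end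

lemma algebra_isomorphic_trans:
  assumes "algebra_isomorphic s1 m1 s2 m2" "algebra_isomorphic s2 m2 s3 m3"
  shows "algebra_isomorphic s1 m1 s3 m3"
proof -
  obtain f g where "Vector_Spaces.linear s1 s2 f" "bij f" "\<forall>x y. f (m1 x y) = m2 (f x) (f y)"
    "Vector_Spaces.linear s2 s3 g" "bij g" "\<forall>x y. g (m2 x y) = m3 (g x) (g y)"
    using assms unfolding algebra_isomorphic_def by blast
  then show ?thesis
    unfolding algebra_isomorphic_def
    by (intro exI[of _ "g \<circ> f"]) (auto intro: Vector_Spaces.linear_compose bij_comp)
qed

lemma isomorphic_vec3_algebra:
  fixes scale :: "complex \<Rightarrow> 'a::ab_group_add \<Rightarrow> 'a"
  assumes S: "semi_alternative_algebra scale mul"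
    and dim: "vector_space.dim scale (UNIV :: 'a set) = 3"
  obtains m :: "complex^3 \<Rightarrow> complex^3 \<Rightarrow> complex^3"
  where "semi_alternative_algebra (*s) m" "algebra_isomorphic scale mul (*s) m"
proof -
  interpret S: semi_alternative_algebra scale mul by (rule S)
  interpret P: vector_space_pair scale "(*s) :: complex \<Rightarrow> complex^3 \<Rightarrow> complex^3" ..
  obtain B where B: "B \<subseteq> UNIV" "S.independent B" "UNIV \<subseteq> S.span B" "card B = S.dim UNIV"
    using S.basis_exists by blast
  have d: "S.dim (UNIV :: 'a set) = vec.dim (UNIV :: (complex^3) set)"
    by (simp add: dim card_cart_basis vec.dim_UNIV)
  have "\<exists>f. Vector_Spaces.linear scale (*s) f \<and> f ` B = (cart_basis :: (complex^3) set)
      \<and> f ` UNIV = UNIV \<and> inj_on f UNIV"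
  proof (rule P.finite_basis_to_basis_subspace_isomorphism[OF S.subspace_UNIV vec.subspace_UNIV d _ B])
    \<comment> \<open>An infinite set has \<open>card\<close> 0, so \<open>card B = 3\<close> gives
      finiteness.\<close>
    show "finite B" using B(4) dim by (metis card.infinite zero_neq_numeral)
  qed (simp_all add: finite_cart_basis independent_cart_basis span_cart_basis vec.dim_UNIV)
  then obtain f where f: "Vector_Spaces.linear scale (*s) f" "bij (f :: 'a \<Rightarrow> complex^3)"
    by (auto simp: bij_def)
  interpret f: Vector_Spaces.linear scale "(*s)" f by (rule f)
  define m where "m u v = f (mul (inv f u) (inv f v))" for u v
  have fm: "f (mul x y) = m (f x) (f y)" for x y
    using f(2) by (simp add: m_def bij_is_inj)
  have ff: "\<exists>x. u = f x" for u
    using f(2) by (metis bij_pointE)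
  have A: "complex_algebra (*s) m"
  proof (intro complex_algebra.intro complex_algebra_axioms.intro vec.vector_space_axioms)
    fix u
    obtain x where [simp]: "u = f x" using ff by blast
    have "m u (v + w) = m u v + m u w" "m u (c *s v) = c *s m u v"
      "m (v + w) u = m v u + m w u" "m (c *s v) u = c *s m v u" for v w c
    proof -
      obtain y z where [simp]: "v = f y" "w = f z" using ff by blast
      show "m u (v + w) = m u v + m u w" "m u (c *s v) = c *s m u v"
        "m (v + w) u = m v u + m w u" "m (c *s v) u = c *s m v u"
        by (simp_all add: fm[symmetric] S.mul_simps f.add[symmetric] f.scale[symmetric])
    qed
    then show "Vector_Spaces.linear (*s) (*s) (m u)" "Vector_Spaces.linear (*s) (*s) (\<lambda>v. m v u)"
      by (unfold_locales) auto
  qed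
  have "associator m u v w = associator m v w u" for u v w
  proof -
    obtain x y z where [simp]: "u = f x" "v = f y" "w = f z" using ff by metis
    show ?thesis
      using arg_cong[OF S.semi_alternative[of x y z], of f]
      by (simp add: associator_def fm f.diff)
  qed
  then have "semi_alternative_algebra (*s) m"
    by (intro semi_alternative_algebra.intro A semi_alternative_algebra_axioms.intro)
  moreover have "algebra_isomorphic scale mul (*s) m"
    unfolding algebra_isomorphic_def using f fm by blast
  ultimately show ?thesis using that by blast
qed

section \<open>Bases of \<open>complex^3\<close> and multiplication tables relative to them\<close>

definition lincomb3 :: "complex^3 \<Rightarrow> complex^3 \<Rightarrow> complex^3 \<Rightarrow> complex^3 \<Rightarrow> complex^3" where
  "lincomb3 x y z v = v $ 1 *s x + v $ 2 *s y + v $ 3 *s z"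

definition indep3 :: "complex^3 \<Rightarrow> complex^3 \<Rightarrow> complex^3 \<Rightarrow> bool" where
  "indep3 x y z \<longleftrightarrow> (\<forall>a b c. a *s x + b *s y + c *s z = 0 \<longrightarrow> a = 0 \<and> b = 0 \<and> c = 0)"

lemma linear_lincomb3: "Vector_Spaces.linear (*s) (*s) (lincomb3 x y z)"
  by unfold_locales (simp_all add: lincomb3_def vec_eq_iff algebra_simps)

lemma bij_lincomb3:
  assumes "indep3 x y z"
  shows "bij (lincomb3 x y z)"
proof -
  have "inj (lincomb3 x y z)"
    unfolding vec.linear_inj_iff_eq_0[OF linear_lincomb3]
  proof (intro allI impI)
    fix v
    assume "lincomb3 x y z v = 0"
    then have "v $ 1 = 0 \<and> v $ 2 = 0 \<and> v $ 3 = 0"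
      using assms unfolding indep3_def lincomb3_def by blast
    then show "v = 0" by (simp add: vec_eq_iff forall_3)
  qed
  then show ?thesis
    using vec.linear_inj_imp_surj[OF linear_lincomb3] by (auto simp: bij_def)
qed

lemma indep3_span:
  assumes "indep3 x y z"
  obtains a b c where "v = a *s x + b *s y + c *s z"
  using bij_lincomb3[OF assms] by (metis lincomb3_def bij_pointE)

lemma indep3_rotate:
  assumes "indep3 x y z"
  shows "indep3 y z x"
  unfolding indep3_def
proof (intro allI impI)
  fix a b c
  assume "a *s y + b *s z + c *s x = 0"
  then have "c *s x + a *s y + b *s z = 0" by (simp add: add_ac)
  then show "a = 0 \<and> b = 0 \<and> c = 0" using assms unfolding indep3_def by blast
qed

lemma indep3_swap: "indep3 x y z \<Longrightarrow> indep3 y x z"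
  unfolding indep3_def by (metis add.commute)

lemma indep3_extend:
  assumes "\<And>a b. a *s x + b *s y = 0 \<Longrightarrow> a = 0 \<and> b = 0"
  obtains z where "indep3 x y z"
proof -
  have "vec.dim {x, y} \<le> card {x, y}" by (rule vec.dim_le_card[OF vec.span_superset]) simp
  also have "\<dots> \<le> 2" by (simp add: card_insert_if)
  finally have "vec.dim {x, y} \<le> 2" .
  then have "vec.span {x, y} \<noteq> UNIV"
  proof -
    have "vec.dim (UNIV :: (complex^3) set) = 3" by (simp add: card_cart_basis)
    then show ?thesis using vec.dim_span[of "{x, y}"] \<open>vec.dim {x, y} \<le> 2\<close> by force
  qed
  then obtain z where z: "z \<notin> vec.span {x, y}" by blast
  have "indep3 x y z"
    unfolding indep3_def
  proof (intro allI impI)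
    fix a b c
    assume *: "a *s x + b *s y + c *s z = 0"
    have "c = 0"
    proof (rule ccontr)
      assume "c \<noteq> 0"
      then have "z = (1 / c) *s (c *s z)" by simp
      also have "c *s z = - (a *s x + b *s y)"
        using * by (metis add.inverse_unique)
      also have "(1 / c) *s \<dots> = (- a / c) *s x + (- b / c) *s y"
        by (simp add: vec_eq_iff algebra_simps)
      also have "\<dots> \<in> vec.span {x, y}"
        by (intro vec.span_add vec.span_scale vec.span_base) auto
      finally show False using z by simp
    qed
    with * assms show "a = 0 \<and> b = 0 \<and> c = 0" by fastforce
  qed
  with that show ?thesis .
qed

text \<open>By bilinearity the nine products of basis vectors decide. \<open>lincomb3 x y z\<close>
  maps coordinates into the algebra, so the isomorphism wanted is its inverse, whose linearity comes
  from a linear left inverse.\<close>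

lemma isomorphic_table_multI:
  assumes "complex_algebra (*s) m" and ind: "indep3 x y z"
    and p: "m x x = lincomb3 x y z (basis_product t 1 1)"
    "m x y = lincomb3 x y z (basis_product t 1 2)"
    "m x z = lincomb3 x y z (basis_product t 1 3)"
    "m y x = lincomb3 x y z (basis_product t 2 1)"
    "m y y = lincomb3 x y z (basis_product t 2 2)"
    "m y z = lincomb3 x y z (basis_product t 2 3)"
    "m z x = lincomb3 x y z (basis_product t 3 1)"
    "m z y = lincomb3 x y z (basis_product t 3 2)"
    "m z z = lincomb3 x y z (basis_product t 3 3)"
  shows "algebra_isomorphic (*s) m (*s) (table_mult t)"
proof -
  interpret complex_algebra "(*s)" m by fact
  let ?f = "lincomb3 x y z"
  interpret f: Vector_Spaces.linear "(*s)" "(*s)" ?f by (rule linear_lincomb3)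
  have b: "bij ?f" by (rule bij_lincomb3[OF ind])
  have h: "?f (table_mult t u v) = m (?f u) (?f v)" for u v
  proof -
    have "m (?f u) (?f v) = (u$1 * v$1) *s m x x + (u$1 * v$2) *s m x y + (u$1 * v$3) *s m x z
      + (u$2 * v$1) *s m y x + (u$2 * v$2) *s m y y + (u$2 * v$3) *s m y z
      + (u$3 * v$1) *s m z x + (u$3 * v$2) *s m z y + (u$3 * v$3) *s m z z"
      by (simp add: lincomb3_def mul_simps vec_eq_iff algebra_simps)
    also have "\<dots> = ?f (table_mult t u v)"
      by (simp add: table_mult_def sum_3 f.add f.scale p)
    finally show ?thesis by simp
  qed
  obtain g where g: "Vector_Spaces.linear (*s) (*s) g" "g \<circ> ?f = id"
    using vec.linear_injective_left_inverse[OF linear_lincomb3 bij_is_inj[OF b]] by blast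
  have li: "Vector_Spaces.linear (*s) (*s) (inv ?f)"
    using g b by (metis bij_is_surj inv_unique_comp o_id surj_iff comp_assoc id_comp)
  show ?thesis
    unfolding algebra_isomorphic_def
  proof (intro exI[of _ "inv ?f"] conjI allI)
    show "inv ?f (m u v) = table_mult t (inv ?f u) (inv ?f v)" for u v
      using b by (intro inv_f_eq) (simp_all add: h bij_is_inj bij_is_surj surj_f_inv_f)
  qed (use li b bij_imp_bij_inv in auto)
qed

section \<open>Common eigenvectors\<close>

text \<open>Split off a root: with \<open>p = (X - r) q\<close>, either \<open>q(T) v\<close> is
  nonzero and an eigenvector for \<open>r\<close>, or \<open>q\<close> annihilates \<open>v\<close>
  too and has smaller degree.\<close>

lemma eigenvector_of_annihilating_poly:
  fixes T :: "complex^3 \<Rightarrow> complex^3" and p :: "complex poly"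
  assumes T: "Vector_Spaces.linear (*s) (*s) T" and V: "vec.subspace V" "\<And>x. x \<in> V \<Longrightarrow> T x \<in> V"
    and v: "v \<in> V" "v \<noteq> 0"
    and p: "p \<noteq> 0" "degree p \<le> n" "(\<Sum>i\<le>n. coeff p i *s (T ^^ i) v) = 0"
  shows "\<exists>a\<in>V. a \<noteq> 0 \<and> (\<exists>r. T a = r *s a)"
  using p
proof (induction n arbitrary: p)
  case 0
  then have "coeff p 0 = 0" using v by (simp add: vec_eq_iff) blast
  with 0 show ?case by (metis le_0_eq leading_coeff_0_iff)
next
  case (Suc n)
  interpret T: Vector_Spaces.linear "(*s)" "(*s)" T by (rule T)
  have nc: "\<not> constant (poly p)"
  proof
    assume "constant (poly p)"
    then have d: "degree p = 0" by (simp add: constant_degree)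
    then have "(\<Sum>i\<le>Suc n. coeff p i *s (T ^^ i) v) = coeff p 0 *s v"
      by (subst sum.atMost_Suc_shift) (simp add: coeff_eq_0)
    then have "coeff p 0 = 0" using Suc.prems v by (simp add: vec_eq_iff) blast
    with d Suc.prems show False by (metis leading_coeff_0_iff)
  qed
  then obtain r where "poly p r = 0" using fundamental_theorem_of_algebra by blast
  then obtain q where q: "p = [:- r, 1:] * q" by (metis dvdE poly_eq_0_iff_dvd)
  have q0: "q \<noteq> 0" using q Suc.prems(1) by auto
  then have "degree p = Suc (degree q)" unfolding q by (subst degree_mult_eq) auto
  then have dq: "degree q \<le> n" using Suc.prems(2) by simp
  define w where "w = (\<Sum>i\<le>n. coeff q i *s (T ^^ i) v)"
  have tv: "(T ^^ i) v \<in> V" for i by (induction i) (auto simp: v V)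
  have w: "w \<in> V" unfolding w_def by (intro vec.subspace_sum vec.subspace_scale V tv)
  have cp: "coeff p 0 = - r * coeff q 0" "coeff p (Suc i) = coeff q i - r * coeff q (Suc i)" for i
    by (simp_all add: q)
  \<comment> \<open>Padding with the zero coefficient at \<open>Suc n\<close> aligns the two sums in
    \<open>T w - r w\<close>.\<close>
  have w': "w = (\<Sum>i\<le>Suc n. coeff q i *s (T ^^ i) v)"
    using dq by (simp add: w_def coeff_eq_0)
  have "0 = (\<Sum>i\<le>Suc n. coeff p i *s (T ^^ i) v)" using Suc.prems by simp
  also have "\<dots> = (\<Sum>i\<le>n. coeff q i *s T ((T ^^ i) v))
      - r *s (\<Sum>i\<le>Suc n. coeff q i *s (T ^^ i) v)"
    unfolding sum.atMost_Suc_shift[of _ n] cp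
    by (simp add: vec.scale_left_diff_distrib sum_subtractf vec.scale_right_distrib
        vec.scale_sum_right)
  also have "\<dots> = T w - r *s w"
    unfolding w'[symmetric] by (simp add: w_def T.sum T.scale)
  finally have "T w = r *s w" by simp
  with Suc.IH[OF q0 dq] w show ?case unfolding w_def by blast
qed

text \<open>Either \<open>v, T v, T (T v)\<close> are independent and express the third iterate,
  which gives a monic cubic, or a dependency between them is an annihilating polynomial of degree at
  most two.\<close>

lemma exists_eigenvector_in_invariant_subspace:
  fixes T :: "complex^3 \<Rightarrow> complex^3"
  assumes T: "Vector_Spaces.linear (*s) (*s) T" and V: "vec.subspace V" "\<And>x. x \<in> V \<Longrightarrow> T x \<in> V"
    and v: "v \<in> V" "v \<noteq> 0"
  shows "\<exists>a\<in>V. a \<noteq> 0 \<and> (\<exists>r. T a = r *s a)"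
proof (cases "indep3 v (T v) (T (T v))")
  case True
  obtain a b c where *: "T (T (T v)) = a *s v + b *s T v + c *s T (T v)"
    by (rule indep3_span[OF True])
  show ?thesis
    by (rule eigenvector_of_annihilating_poly[OF T V v, of "[:-a, -b, -c, 1:]" 3])
      (auto simp: eval_nat_numeral * algebra_simps)
next
  case False
  then obtain a b c where *: "a *s v + b *s T v + c *s T (T v) = 0"
    and nz: "a \<noteq> 0 \<or> b \<noteq> 0 \<or> c \<noteq> 0"
    unfolding indep3_def by blast
  show ?thesis
    by (rule eigenvector_of_annihilating_poly[OF T V v, of "[:a, b, c:]" 2])
      (use nz in \<open>auto simp: eval_nat_numeral *\<close>)
qed

text \<open>If \<open>v\<close> is not an eigenvector of \<open>T i\<close>, an eigenspace of
  \<open>T i\<close> in \<open>V\<close> is a smaller subspace invariant under all operators.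
  Commutation is required on \<open>V\<close> only, because the transposed operators of the
  application are known to commute only there.\<close>

lemma exists_common_eigenvector:
  fixes T :: "'i \<Rightarrow> complex^3 \<Rightarrow> complex^3"
  assumes T: "\<And>i. Vector_Spaces.linear (*s) (*s) (T i)"
    and "vec.subspace V" "\<And>i x. x \<in> V \<Longrightarrow> T i x \<in> V"
      "\<And>i j x. x \<in> V \<Longrightarrow> T i (T j x) = T j (T i x)" "v \<in> V" "v \<noteq> 0"
  shows "\<exists>a\<in>V. a \<noteq> 0 \<and> (\<forall>i. \<exists>r. T i a = r *s a)"
  using assms(2-)
proof (induction "vec.dim V" arbitrary: V v rule: less_induct)
  case less
  show ?case
  proof (cases "\<forall>i. \<exists>r. T i v = r *s v")
    case False
    then obtain i where i: "\<nexists>r. T i v = r *s v" by blast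
    obtain a r where a: "a \<in> V" "a \<noteq> 0" "T i a = r *s a"
      using exists_eigenvector_in_invariant_subspace[OF T less.prems(1,2,4,5)] by blast
    interpret Ti: Vector_Spaces.linear "(*s)" "(*s)" "T i" by (rule T)
    let ?W = "{x \<in> V. T i x = r *s x}"
    have W: "vec.subspace ?W"
      using less.prems(1)
      by (auto simp: vec.subspace_def Ti.add Ti.scale Ti.zero vec_eq_iff algebra_simps)
    have "?W \<subset> V" using less.prems(4) i by auto
    then have "vec.dim ?W < vec.dim V"
      using vec.dim_psubset[of ?W V] W[THEN vec.span_eq_iff[THEN iffD2]]
        less.prems(1)[THEN vec.span_eq_iff[THEN iffD2]] by simp
    moreover have "T j x \<in> ?W" if "x \<in> ?W" for j x
    proof -
      interpret Tj: Vector_Spaces.linear "(*s)" "(*s)" "T j" by (rule T)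
      have "T i (T j x) = T j (T i x)" using that less.prems(3) by blast
      then show ?thesis using that less.prems(2) by (simp add: Tj.scale)
    qed
    ultimately have "\<exists>a\<in>?W. a \<noteq> 0 \<and> (\<forall>i. \<exists>r. T i a = r *s a)"
      using less.prems(3) a by (intro less.hyps[OF _ W, where v = a]) auto
    then show ?thesis by blast
  qed (use less.prems in blast)
qed

section \<open>The trace forms of the multiplication operators\<close>

text \<open>Cayley-Hamilton with coefficients rewritten in power traces by Newton's identities:
  \<open>s\<close> is the second elementary symmetric function of the eigenvalues, \<open>d\<close>
  the determinant. The identity is checked entry by entry.\<close>

lemma matrix3_cube_eq_0:
  fixes A :: "complex^3^3"
  assumes "trace A = 0" "trace (A ** A) = 0" "trace (A ** A ** A) = 0"
  shows "A ** A ** A = 0"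
proof -
  define s where "s = (trace A ^ 2 - trace (A ** A)) / 2"
  define d where "d = (trace A ^ 3 - 3 * trace A * trace (A ** A) + 2 * trace (A ** A ** A)) / 6"
  have "(A ** A ** A) $ i $ j = trace A * (A ** A) $ i $ j - s * A $ i $ j + d * (mat 1 :: complex^3^3) $ i $ j"
    for i j
  proof -
    have "\<forall>i j. (A ** A ** A) $ i $ j = trace A * (A ** A) $ i $ j - s * A $ i $ j
        + d * (mat 1 :: complex^3^3) $ i $ j"
      unfolding forall_3 s_def d_def trace_def matrix_matrix_mult_def mat_def
      by (simp add: sum_3 field_simps power2_eq_square power3_eq_cube)
    then show ?thesis by blast
  qed
  then show ?thesis using assms by (simp add: vec_eq_iff s_def d_def)
qed

text \<open>The identity says that the fourth elementary symmetric function of three eigenvalues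
  vanishes, written in power sums.\<close>

lemma matrix3_trace_eq_0:
  fixes A :: "complex^3^3"
  assumes "trace (A ** A) = 0" "trace (A ** A ** A) = 0" "trace (A ** A ** A ** A) = 0"
  shows "trace A = 0"
proof -
  have "trace A ^ 4 = 6 * trace A ^ 2 * trace (A ** A) - 3 * trace (A ** A) ^ 2
     - 8 * trace A * trace (A ** A ** A) + 6 * trace (A ** A ** A ** A)"
    unfolding trace_def matrix_matrix_mult_def by (simp add: sum_3) algebra
  with assms show ?thesis by simp
qed

lemma matrix_add_diff_rdistrib:
  fixes A :: "'a::ring_1^'n^'m"
  shows "(A + B - C) ** D = A ** D + B ** D - C ** D"
  by (simp add: matrix_matrix_mult_def vec_eq_iff sum.distrib sum_subtractf algebra_simps)

section \<open>Trace identities of a semi-alternative multiplication\<close>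

locale semi_alternative_vec3 = semi_alternative_algebra "(*s)" m
  for m :: "complex^3 \<Rightarrow> complex^3 \<Rightarrow> complex^3"
begin

lemma cyclic: "m (m x y) z - m x (m y z) = m (m y z) x - m y (m z x)"
  using semi_alternative unfolding associator_def .

text \<open>Reversal sends the associator of \<open>x, y, z\<close> to minus that of
  \<open>z, y, x\<close>, which respects 3-cycles. Right-handed statements follow from left-handed
  ones in this way.\<close>

lemma opposite: "semi_alternative_vec3 (\<lambda>x y. m y x)"
proof (intro semi_alternative_vec3.intro semi_alternative_algebra.intro
    semi_alternative_algebra_axioms.intro complex_algebra_opposite)
  fix x y z
  show "associator (\<lambda>x y. m y x) x y z = associator (\<lambda>x y. m y x) y z x"
    using cyclic[of z y x] cyclic[of y x z] unfolding associator_def by (metis minus_diff_eq)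
qed

definition L :: "complex^3 \<Rightarrow> complex^3^3" where "L x = matrix (m x)"
definition R :: "complex^3 \<Rightarrow> complex^3^3" where "R x = matrix (\<lambda>y. m y x)"
definition lam :: "complex^3 \<Rightarrow> complex" where "lam x = trace (L x)"

lemma L_vec [simp]: "L x *v y = m x y" and R_vec [simp]: "R x *v y = m y x"
  unfolding L_def R_def
  by (simp_all add: matrix_works[OF linear_mul_right] matrix_works[OF linear_mul_left])

lemma L_mul: "L (m x y) = L x ** L y + R x ** L y - L y ** R x"
  unfolding matrix_eq
proof
  fix v
  show "L (m x y) *v v = (L x ** L y + R x ** L y - L y ** R x) *v v"
    using cyclic[of x y v]
    by (simp add: matrix_vector_mult_diff_rdistrib matrix_vector_mult_add_rdistrib
        matrix_vector_mul_assoc[symmetric] algebra_simps)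
qed

lemma lam_add: "lam (x + y) = lam x + lam y"
  and lam_scale: "lam (c *s x) = c * lam x"
  and lam_diff: "lam (x - y) = lam x - lam y"
  by (simp_all add: lam_def L_def trace_def matrix_def mul_simps sum.distrib sum_distrib_left
      sum_subtractf)

lemma lam_zero: "lam 0 = 0"
  using lam_scale[of 0 0] by simp

lemma lam_mul: "lam (m x y) = trace (L x ** L y)"
  by (simp add: lam_def L_mul trace_add trace_sub trace_mul_sym[of "R x"])

lemma lam_mul_commute: "lam (m x y) = lam (m y x)"
  unfolding lam_mul by (rule trace_mul_sym)

text \<open>Let \<open>t1, t2, t3\<close> be the values of \<open>lam\<close> at
  \<open>(xy)z\<close>, \<open>(yz)x\<close>, \<open>(zx)y\<close>. As \<open>lam\<close> is
  symmetric on products, the three cyclic associators have the values \<open>t1 - t2\<close>,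
  \<open>t2 - t3\<close>, \<open>t3 - t1\<close>; these are equal and add up to zero.\<close>

lemma lam_assoc: "lam (m (m x y) z) = lam (m x (m y z))"
proof -
  have t: "lam (m u (m v w)) = lam (m (m v w) u)" for u v w by (rule lam_mul_commute)
  have "lam (m (m x y) z) - lam (m (m y z) x) = lam (m (m y z) x) - lam (m (m z x) y)"
    "lam (m (m y z) x) - lam (m (m z x) y) = lam (m (m z x) y) - lam (m (m x y) z)"
    using arg_cong[OF cyclic[of x y z], of lam] arg_cong[OF cyclic[of y z x], of lam]
    unfolding lam_diff t by simp_all
  then have "3 * lam (m (m x y) z) = 3 * lam (m (m y z) x)" by algebra
  then show ?thesis unfolding t by simp
qed

text \<open>A 3-cycle of the first three arguments preserves \<open>alt4\<close> and a 4-cycle of all arguments changes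
  its sign; these permutations generate the symmetric group, so \<open>alt4\<close> is alternating.\<close>

definition alt4 :: "complex^3 \<Rightarrow> complex^3 \<Rightarrow> complex^3 \<Rightarrow> complex^3 \<Rightarrow> complex" where
  "alt4 x y z w = lam (m (m (m x y) z - m x (m y z)) w)"

lemma alt4_cyclic3: "alt4 x y z w = alt4 y z x w"
  unfolding alt4_def by (subst cyclic) rule

text \<open>Moving brackets under \<open>lam\<close> brings both sides to the terms
  \<open>lam ((xy)(zw))\<close> and \<open>lam (x((yz)w))\<close>, with opposite signs.\<close>

lemma alt4_cyclic4: "alt4 x y z w = - alt4 y z w x"
proof -
  have "alt4 x y z w = lam (m (m x y) (m z w)) - lam (m x (m (m y z) w))"
    unfolding alt4_def mul_simps lam_diff by (simp add: lam_assoc)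
  moreover have "alt4 y z w x = lam (m x (m (m y z) w)) - lam (m (m x y) (m z w))"
    unfolding alt4_def mul_simps lam_diff by (simp add: lam_assoc lam_mul_commute[of _ x])
  ultimately show ?thesis by simp
qed

lemma alt4_eq_args: "alt4 x y z x = 0" "alt4 x y z y = 0" "alt4 x y z z = 0"
  "alt4 x x z w = 0" "alt4 x z x w = 0" "alt4 z x x w = 0"
proof -
  \<comment> \<open>One 4-cycle followed by two 3-cycles exchanges the first and the last
    argument.\<close>
  have sw: "alt4 x y z w = - alt4 w y z x" for x y z w
    by (subst alt4_cyclic4) (subst alt4_cyclic3, subst alt4_cyclic3, simp)
  show 1: "alt4 x y z x = 0" for x y z using sw[of x y z x] by simp
  show "alt4 x y z y = 0" using 1[of y z x] alt4_cyclic3 by metis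
  show "alt4 x y z z = 0" using 1[of z x y] alt4_cyclic3 by metis
  show 4: "alt4 x x z w = 0" for x z w using alt4_cyclic4[of x x z w] 1[of x z w] by simp
  show "alt4 x z x w = 0" using 4[of x z w] alt4_cyclic3 by metis
  show "alt4 z x x w = 0" using 4[of x z w] alt4_cyclic3 by metis
qed

lemma alt4_linear:
  "alt4 (a *s x + b *s y + c *s z) u v w = a * alt4 x u v w + b * alt4 y u v w + c * alt4 z u v w"
  "alt4 u v w (a *s x + b *s y + c *s z) = a * alt4 u v w x + b * alt4 u v w y + c * alt4 u v w z"
  unfolding alt4_def mul_simps lam_add lam_diff lam_scale by (simp_all add: algebra_simps)

lemma alt4_eq_0: "alt4 x y z w = 0"
proof (cases "indep3 x y z")
  case True
  then obtain a b c where "w = a *s x + b *s y + c *s z" by (rule indep3_span)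
  then show ?thesis by (simp add: alt4_linear alt4_eq_args)
next
  case False
  then obtain a b c where *: "a *s x + b *s y + c *s z = 0" and nz: "a \<noteq> 0 \<or> b \<noteq> 0 \<or> c \<noteq> 0"
    unfolding indep3_def by blast
  have z: "alt4 0 u v w = 0" for u v
    unfolding alt4_def mul_simps by (simp add: mul_simps lam_zero)
  have "a * alt4 x y z w = 0" "b * alt4 y z x w = 0" "c * alt4 z x y w = 0"
    using alt4_linear(1)[of a x b y c z y z w] alt4_linear(1)[of a x b y c z z x w]
      alt4_linear(1)[of a x b y c z x y w]
    by (simp_all add: * z alt4_eq_args)
  moreover have "alt4 x y z w = alt4 y z x w" "alt4 x y z w = alt4 z x y w"
    using alt4_cyclic3 by metis+
  ultimately show ?thesis using nz by auto
qed

lemma lam_mul_assoc: "lam (m (m (m x y) z) w) = lam (m (m x (m y z)) w)"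
  using alt4_eq_0[of x y z w] unfolding alt4_def mul_simps lam_diff by simp

text \<open>The trilinear \<open>T\<close> is alternating. A nonzero value would make it a volume
  form, hence the three commutators of \<open>x, y, z\<close> independent and therefore spanning;
  but \<open>lam\<close> vanishes on commutators.\<close>

lemma lam_commutator_eq_0:
  assumes "lam s \<noteq> 0"
  shows "lam (m (m x y) z) = lam (m (m y x) z)"
proof (rule ccontr)
  define T where "T x y z = lam (m (m x y - m y x) z)" for x y z
  assume "\<not> ?thesis"
  then have nz: "T x y z \<noteq> 0" unfolding T_def mul_simps lam_diff by simp
  have cyc: "T x y z = T y z x" for x y z
    unfolding T_def mul_simps lam_diff by (simp add: lam_assoc lam_mul_commute[of _ x])
      (metis lam_assoc lam_mul_commute)
  have al: "T u u v = 0" "T u v v = 0" "T u v u = 0" for u v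
    using cyc[of u u v] cyc[of u v v] by (simp_all add: T_def mul_simps lam_zero)
  have lin: "T u v (a *s x + b *s y + c *s z) = a * T u v x + b * T u v y + c * T u v z" for u v a b c
    unfolding T_def mul_simps lam_add lam_diff lam_scale by (simp add: algebra_simps)
  have "indep3 (m y z - m z y) (m z x - m x z) (m x y - m y x)"
    unfolding indep3_def
  proof (intro allI impI)
    fix a b c
    let ?u = "a *s (m y z - m z y) + b *s (m z x - m x z) + c *s (m x y - m y x)"
    assume 0: "?u = 0"
    have e: "lam (m ?u w) = a * T y z w + b * T z x w + c * T x y w" for w
      unfolding T_def mul_simps lam_add lam_diff lam_scale by (simp add: algebra_simps)
    have "a * T y z w + b * T z x w + c * T x y w = 0" for w
      unfolding e[symmetric] 0 by (simp add: mul_simps lam_zero)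
    \<comment> \<open>Evaluation at \<open>x\<close>, \<open>y\<close>, \<open>z\<close> isolates
      \<open>a\<close>, \<open>b\<close>, \<open>c\<close> in turn.\<close>
    from this[of x] this[of y] this[of z]
    show "a = 0 \<and> b = 0 \<and> c = 0"
      using nz al cyc[of x y z] cyc[of y z x] by auto
  qed
  then obtain a b c where "s = a *s (m y z - m z y) + b *s (m z x - m x z) + c *s (m x y - m y x)"
    by (rule indep3_span)
  then have "lam s = 0"
    by (simp add: lam_add lam_scale lam_diff lam_mul_commute[of z y] lam_mul_commute[of x z]
        lam_mul_commute[of y x])
  with assms show False by simp
qed

text \<open>Multiplying by \<open>x\<close> on the right appends a factor \<open>L x\<close> under
  the trace, because the two terms of \<open>L_mul\<close> that contain \<open>R u\<close> cancel by
  cyclicity.\<close>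

lemma lam_powers:
  "lam (m x x) = trace (L x ** L x)"
  "lam (m (m x x) x) = trace (L x ** L x ** L x)"
  "lam (m (m (m x x) x) x) = trace (L x ** L x ** L x ** L x)"
proof -
  let ?A = "L x"
  have k: "trace (L (m u x) ** ?A) = trace (L u ** ?A ** ?A)" for u
  proof -
    have "trace (L (m u x) ** ?A)
       = trace (L u ** ?A ** ?A) + trace (R u ** ?A ** ?A) - trace (?A ** R u ** ?A)"
      by (simp add: L_mul matrix_add_diff_rdistrib trace_add trace_sub)
    also have "trace (?A ** R u ** ?A) = trace (R u ** ?A ** ?A)"
      by (metis matrix_mul_assoc trace_mul_sym)
    finally show ?thesis by simp
  qed
  show "lam (m x x) = trace (L x ** L x)"
    "lam (m (m x x) x) = trace (L x ** L x ** L x)"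
    by (simp_all add: lam_mul k)
  have k2: "trace (L (m u x) ** ?A ** ?A) = trace (L u ** ?A ** ?A ** ?A)" for u
  proof -
    have "trace (L (m u x) ** ?A ** ?A)
       = trace (L u ** ?A ** ?A ** ?A) + trace (R u ** ?A ** ?A ** ?A) - trace (?A ** R u ** ?A ** ?A)"
      by (simp add: L_mul matrix_add_diff_rdistrib trace_add trace_sub)
    also have "trace (?A ** R u ** ?A ** ?A) = trace (R u ** ?A ** ?A ** ?A)"
      by (metis matrix_mul_assoc trace_mul_sym)
    finally show ?thesis by simp
  qed
  show "lam (m (m (m x x) x) x) = trace (L x ** L x ** L x ** L x)"
    by (simp add: lam_mul k k2)
qed

text \<open>If \<open>z\<close> is in the radical of the trace form, \<open>lam\<close> vanishes on
  its powers of degree 2, 3, 4, so these power traces of \<open>L z\<close> are zero, and in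
  dimension three the trace itself is then zero. Hence the form is nonzero whenever
  \<open>lam\<close> is.\<close>

lemma lam_eq_0_of_radical:
  assumes "\<And>y. lam (m z y) = 0"
  shows "lam z = 0"
proof -
  have "lam (m (m z z) z) = 0" "lam (m (m (m z z) z) z) = 0"
    using assms lam_mul_commute[of _ z] by simp_all
  then show ?thesis
    using assms[of z] matrix3_trace_eq_0[of "L z"] unfolding lam_powers lam_def[of z] by blast
qed

lemma left_nilpotent_of_lam_0:
  assumes "\<And>x. lam x = 0"
  shows "m x (m x (m x y)) = 0"
proof -
  have "L x ** L x ** L x = 0"
  proof (rule matrix3_cube_eq_0)
    show "trace (L x) = 0" using assms[of x] unfolding lam_def .
    show "trace (L x ** L x) = 0" using assms[of "m x x"] unfolding lam_powers .
    show "trace (L x ** L x ** L x) = 0" using assms[of "m (m x x) x"] unfolding lam_powers .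
  qed
  then have "(L x ** L x ** L x) *v y = 0" by simp
  then show ?thesis by (simp flip: matrix_vector_mul_assoc)
qed

section \<open>Characters from a nonvanishing trace\<close>

definition character :: "(complex^3 \<Rightarrow> complex) \<Rightarrow> bool" where
  "character \<theta> \<longleftrightarrow> (\<forall>x y. \<theta> (x + y) = \<theta> x + \<theta> y) \<and> (\<forall>c x. \<theta> (c *s x) = c * \<theta> x) \<and>
     (\<forall>x y. \<theta> (m x y) = \<theta> x * \<theta> y) \<and> (\<exists>x. \<theta> x \<noteq> 0)"

text \<open>A common eigenvector \<open>a\<close> of the transposed left multiplications satisfies
  \<open>a(xy) = r(x) a(y)\<close>. It is symmetric on products, so \<open>r\<close> is a multiple
  \<open>k a\<close>, and then \<open>k a\<close> is multiplicative.\<close>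

lemma exists_character_of_lam:
  assumes s: "lam s \<noteq> 0"
  shows "\<exists>\<theta>. character \<theta>"
proof -
  \<comment> \<open>Functionals are encoded as vectors through the coordinate pairing, so that the
    eigenvector lemma for operators on \<open>complex^3\<close> applies.\<close>
  define pr :: "complex^3 \<Rightarrow> complex^3 \<Rightarrow> complex" where "pr a y = (\<Sum>i\<in>UNIV. a $ i * y $ i)" for a y
  have pr_add: "pr (a + b) y = pr a y + pr b y" and pr_scale: "pr (c *s a) y = c * pr a y"
    for a b y c
    by (simp_all add: pr_def sum.distrib sum_distrib_left algebra_simps)
  have pr_inj: "a = b" if "\<And>y. pr a y = pr b y" for a b
  proof -
    have "a $ i = b $ i" for i
      using that[of "axis i 1"] by (simp add: pr_def axis_def if_distrib[of "(*) _"] cong: if_cong)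
    then show ?thesis by (simp add: vec_eq_iff)
  qed
  define T where "T x a = transpose (L x) *v a" for x a
  have lin: "Vector_Spaces.linear (*s) (*s) (T x)" for x
    using matrix_vector_mul_linear_gen[of "transpose (L x)"] by (simp only: T_def[abs_def])
  have pr_T: "pr (T x a) y = pr a (m x y)" for x a y
  proof -
    have "pr a (L x *v y) = pr (T x a) y"
      by (simp add: pr_def T_def matrix_vector_mult_def transpose_def sum_3 algebra_simps del: L_vec)
    then show ?thesis by simp
  qed
  define V where "V = {a. \<exists>w. \<forall>y. pr a y = lam (m w y)}"
  have V: "vec.subspace V"
  proof (rule vec.subspaceI)
    show "0 \<in> V" unfolding V_def by (auto intro!: exI[of _ 0] simp: pr_def mul_simps lam_zero)
    fix a b c assume "a \<in> V" "b \<in> V"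
    then obtain w1 w2 where w: "\<And>y. pr a y = lam (m w1 y)" "\<And>y. pr b y = lam (m w2 y)"
      unfolding V_def by blast
    have "\<forall>y. pr (a + b) y = lam (m (w1 + w2) y)" "\<forall>y. pr (c *s a) y = lam (m (c *s w1) y)"
      by (simp_all add: pr_add pr_scale w mul_simps lam_add lam_scale)
    then show "a + b \<in> V" "c *s a \<in> V" unfolding V_def by blast+
  qed
  \<comment> \<open>Since \<open>lam (w(xy)) = lam ((wx)y)\<close>, the operator \<open>T x\<close>
    replaces \<open>w\<close> by \<open>wx\<close>.\<close>
  have TV: "T x a \<in> V" if "a \<in> V" for x a
    using that by (auto simp: V_def pr_T lam_assoc[symmetric])
  have TT: "T x (T y a) = T y (T x a)" if aV: "a \<in> V" for x y a
  proof (rule pr_inj)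
    fix z
    obtain w where w: "\<And>y. pr a y = lam (m w y)" using aV unfolding V_def by blast
    have "lam (m w (m y (m x z))) = lam (m (m (m y x) z) w)"
      by (metis lam_mul_commute lam_mul_assoc lam_assoc)
    also have "\<dots> = lam (m (m y x) (m z w))" by (rule lam_assoc)
    also have "\<dots> = lam (m (m x y) (m z w))" by (rule lam_commutator_eq_0[OF s])
    also have "\<dots> = lam (m (m (m x y) z) w)" by (rule lam_assoc[symmetric])
    also have "\<dots> = lam (m w (m x (m y z)))"
      by (metis lam_mul_commute lam_mul_assoc lam_assoc)
    finally show "pr (T x (T y a)) z = pr (T y (T x a)) z" by (simp add: pr_T w)
  qed
  obtain z y where zy: "lam (m z y) \<noteq> 0" using lam_eq_0_of_radical s by blast
  define v where "v = (\<chi> i. lam (m z (axis i 1)))"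
  have pv: "pr v y = lam (m z y)" for y
  proof -
    have "y = (\<Sum>i\<in>UNIV. y $ i *s axis i 1)" by (rule basis_expansion[symmetric])
    then have "lam (m z y) = lam (m z (\<Sum>i\<in>UNIV. y $ i *s axis i 1))" by simp
    then show ?thesis
      by (simp add: pr_def v_def sum_3 mul_simps lam_add lam_scale algebra_simps)
  qed
  have "v \<in> V" unfolding V_def using pv by blast
  moreover have "v \<noteq> 0" using zy unfolding pv[symmetric] by (auto simp: pr_def)
  ultimately obtain a where a: "a \<in> V" "a \<noteq> 0" and ev: "\<forall>x. \<exists>r. T x a = r *s a"
    using exists_common_eigenvector[of T V v, OF lin V TV TT] by blast
  obtain r where r: "\<And>x. T x a = r x *s a" using ev by metis
  obtain w where w: "\<And>y. pr a y = lam (m w y)" using a unfolding V_def by blast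
  obtain y0 where y0: "pr a y0 \<noteq> 0" using a(2) pr_inj[of a 0] by (auto simp: pr_def)
  have mult: "pr a (m x y) = r x * pr a y" for x y
    using pr_T[of x a y] by (simp add: r pr_scale)
  have "pr a (m x y) = pr a (m y x)" for x y
    using lam_commutator_eq_0[OF s, of x y w] by (simp add: w lam_mul_commute[of w])
  then have sym: "r x * pr a y = r y * pr a x" for x y by (metis mult)
  define k where "k = r y0 / pr a y0"
  have rk: "r x = k * pr a x" for x using sym[of x y0] y0 by (simp add: k_def field_simps)
  \<comment> \<open>For \<open>k = 0\<close> all \<open>lam ((wx)y)\<close> vanish, so every
    \<open>wx\<close> lies in the radical, and then \<open>lam (wx) = 0\<close> for all
    \<open>x\<close>, against \<open>a\<close> being nonzero.\<close>
  have "k \<noteq> 0"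
  proof
    assume "k = 0"
    then have "lam (m (m w x) y) = 0" for x y
      using mult[of x y] by (simp add: rk w lam_assoc)
    then have "lam (m w x) = 0" for x using lam_eq_0_of_radical by blast
    then show False using y0 w by simp
  qed
  then have "character (\<lambda>x. k * pr a x)"
    unfolding character_def
    using y0 mult rk
    by (auto simp: w mul_simps lam_add lam_scale algebra_simps)
  then show ?thesis by blast
qed

end

lemma (in semi_alternative_vec3) character_or_nil:
  obtains \<theta> where "character \<theta>"
  | "\<And>x y. m x (m x (m x y)) = 0" "\<And>x y. m (m (m y x) x) x = 0"
proof -
  interpret o: semi_alternative_vec3 "\<lambda>x y. m y x" by (rule opposite)
  consider s where "lam s \<noteq> 0" | s where "o.lam s \<noteq> 0" | "\<And>x. lam x = 0" "\<And>x. o.lam x = 0"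
    by blast
  then show ?thesis
  proof cases
    case 1
    then show ?thesis using exists_character_of_lam that(1) by blast
  next
    case 2
    then obtain \<theta> where "o.character \<theta>" using o.exists_character_of_lam by blast
    then have "character \<theta>" unfolding character_def o.character_def by (simp add: mult.commute)
    then show ?thesis using that(1) by blast
  next
    case 3
    then show ?thesis using left_nilpotent_of_lam_0 o.left_nilpotent_of_lam_0 that(2) by blast
  qed
qed

section \<open>Recognizing the algebras of the list\<close>

definition listed :: "(complex^3 \<Rightarrow> complex^3 \<Rightarrow> complex^3) \<Rightarrow> bool" where
  "listed M \<longleftrightarrow> M \<in> {A01, A02, A03, A04, A05, A06, A07, A08, A09, A10, A11, A12,
       A13, A15, A16, A17, A18, A19, A20, A21, A22, A23, A24} \<or>
     (\<exists>\<alpha>. \<alpha> \<noteq> 0 \<and> M = A14 \<alpha>) \<or> (\<exists>\<alpha>. M = S01 \<alpha>) \<or>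
     M \<in> {S02, S03, S04, S05, S06, S07, S08, S09, S10, S11, S12, S13}"

definition classified :: "(complex^3 \<Rightarrow> complex^3 \<Rightarrow> complex^3) \<Rightarrow> bool" where
  "classified m \<longleftrightarrow> (\<exists>M. listed M \<and> algebra_isomorphic (*s) m (*s) M)"

lemma classifiedI: "algebra_isomorphic (*s) m (*s) M \<Longrightarrow> listed M \<Longrightarrow> classified m"
  unfolding classified_def by blast

lemmas table_defs = A01_def A02_def A03_def A04_def A05_def A06_def A07_def A08_def A09_def
  A10_def A11_def A12_def A13_def A14_def A15_def A16_def A17_def A18_def A19_def A20_def
  A21_def A22_def A23_def A24_def S01_def S02_def S03_def S04_def S05_def S06_def S07_def
  S08_def S09_def S10_def S11_def S12_def S13_def comm_table_mult_def

lemmas table_entry_simps = lincomb3_def basis_product_def axis_def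

lemma indep3D:
  assumes "indep3 x y z" "a *s x + b *s y + c *s z = 0"
  shows "a = 0" "b = 0" "c = 0"
  using assms unfolding indep3_def by blast+

lemma indep3_eqD:
  assumes "indep3 x y z" "a *s x + b *s y + c *s z = a' *s x + b' *s y + c' *s z"
  shows "a = a'" "b = b'" "c = c'"
proof -
  have "(a - a') *s x + (b - b') *s y + (c - c') *s z = 0"
    using assms(2) by (simp add: vec.scale_left_diff_distrib algebra_simps)
  from indep3D[OF assms(1) this] show "a = a'" "b = b'" "c = c'" by simp_all
qed

lemma indep3_nz: "indep3 x y z \<Longrightarrow> x \<noteq> 0 \<and> y \<noteq> 0 \<and> z \<noteq> 0"
  using indep3D[of x y z 1 0 0] indep3D[of x y z 0 1 0] indep3D[of x y z 0 0 1] by auto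

lemma indep3_lincombI:
  assumes "indep3 x y z" and u: "u = a1 *s x + a2 *s y + a3 *s z"
    "v = b1 *s x + b2 *s y + b3 *s z" "w = c1 *s x + c2 *s y + c3 *s z"
    and det: "a1 * (b2 * c3 - b3 * c2) - a2 * (b1 * c3 - b3 * c1) + a3 * (b1 * c2 - b2 * c1) \<noteq> 0"
  shows "indep3 u v w"
  unfolding indep3_def
proof (intro allI impI)
  fix p q r
  assume "p *s u + q *s v + r *s w = 0"
  then have "(p * a1 + q * b1 + r * c1) *s x + (p * a2 + q * b2 + r * c2) *s y
    + (p * a3 + q * b3 + r * c3) *s z = 0"
    unfolding u by (simp add: vec_eq_iff algebra_simps)
  note e = indep3D[OF assms(1) this]
  let ?d = "a1 * (b2 * c3 - b3 * c2) - a2 * (b1 * c3 - b3 * c1) + a3 * (b1 * c2 - b2 * c1)"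
  \<comment> \<open>Cramer's rule: each product is a combination of the three equations
    \<open>e\<close>.\<close>
  have "p * ?d = 0" "q * ?d = 0" "r * ?d = 0" using e by algebra+
  with det show "p = 0 \<and> q = 0 \<and> r = 0" by simp
qed

section \<open>Nilpotent algebras\<close>

lemma vec_eq_neg_iff: "v = - v \<longleftrightarrow> v = 0" for v :: "complex^3"
  by (auto simp: vec_eq_iff)

context semi_alternative_vec3
begin

text \<open>The algebra is the Heisenberg Lie algebra. The product is anticommutative, and the
  associators of \<open>a, a, b\<close> and \<open>a, b, a\<close> then give
  \<open>a(ab) = 0\<close>, so \<open>xy\<close> is annihilated by \<open>x\<close> and
  \<open>y\<close>.\<close>

lemma classified_square_zero:
  assumes sq: "\<And>x. m x x = 0" and "m x y \<noteq> 0"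
  shows "classified m"
proof -
  define u where "u = m x y"
  have ac: "m a b = - m b a" for a b
  proof -
    have "m (a + b) (a + b) = m a a + m b b + (m a b + m b a)"
      unfolding mul_add_left mul_add_right by (simp add: add_ac)
    then show ?thesis unfolding sq by (simp add: eq_neg_iff_add_eq_0)
  qed
  have ll: "m a (m a b) = 0" for a b
  proof -
    have "m (m a b) a = - m a (m a b)" "m a (m b a) = - m a (m a b)"
      using ac[of b a] by (simp_all add: ac[of "m a b" a] mul_simps)
    then show ?thesis using cyclic[of a a b] by (simp add: sq mul_simps)
  qed
  have p: "m x x = 0" "m y y = 0" "m u u = 0" "m x y = u" "m y x = - u"
    "m x u = 0" "m u x = 0" "m y u = 0" "m u y = 0"
  proof -
    show "m x u = 0" unfolding u_def by (rule ll)
    then show "m u x = 0" using ac[of u x] by simp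
    have "m y u = - m y (m y x)" unfolding u_def by (subst ac[of x y]) (simp add: mul_simps)
    then show "m y u = 0" by (simp add: ll)
    then show "m u y = 0" using ac[of u y] by simp
    show "m y x = - u" unfolding u_def by (rule ac)
  qed (simp_all add: sq u_def)
  have u0: "u \<noteq> 0" using assms(2) by (simp add: u_def)
  have ind: "indep3 x y u"
    unfolding indep3_def
  proof (intro allI impI)
    fix a b c
    assume 0: "a *s x + b *s y + c *s u = 0"
    have "b *s u = m x (a *s x + b *s y + c *s u)" "- (a *s u) = m y (a *s x + b *s y + c *s u)"
      by (simp_all add: mul_simps p)
    then have "a = 0" "b = 0" unfolding 0 using u0 by (auto simp: mul_simps)
    then show "a = 0 \<and> b = 0 \<and> c = 0" using 0 u0 by auto
  qed
  have "algebra_isomorphic (*s) m (*s) A12"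
    unfolding table_defs
    by (rule isomorphic_table_multI[OF complex_algebra_axioms ind])
      (simp_all add: table_entry_simps p)
  then show ?thesis by (rule classifiedI) (simp add: listed_def)
qed

text \<open>The products of \<open>x\<close> and \<open>w\<close> are a bilinear form with values in
  the line of \<open>y\<close> and Gram matrix \<open>(1 k; -k d)\<close>. What remains is its
  normal form under change of basis.\<close>

lemma classified_form:
  assumes ind: "indep3 x y w"
    and p: "m x x = y" "m x y = 0" "m y x = 0" "m y y = 0" "m y w = 0" "m w y = 0"
      "m x w = k *s y" "m w x = - k *s y" "m w w = d *s y"
  shows "classified m"
proof -
  consider "d = 0" "k = 0" | "d = 0" "k \<noteq> 0" | "d \<noteq> 0" by blast
  then show ?thesis
  proof cases
    case 1
    have "algebra_isomorphic (*s) m (*s) A04"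
      unfolding table_defs
      by (rule isomorphic_table_multI[OF complex_algebra_axioms ind])
        (simp_all add: table_entry_simps p 1)
    then show ?thesis by (rule classifiedI) (simp add: listed_def)
  next
    case 2
    have ind': "indep3 x y ((1 / k) *s w)"
      by (rule indep3_lincombI[OF ind, of _ 1 0 0 _ 0 1 0 _ 0 0 "1/k"]) (use 2 in auto)
    have "algebra_isomorphic (*s) m (*s) A13"
      unfolding table_defs
      by (rule isomorphic_table_multI[OF complex_algebra_axioms ind'])
        (use 2 in \<open>simp_all add: table_entry_simps p mul_simps\<close>)
    then show ?thesis by (rule classifiedI) (simp add: listed_def)
  next
    case 3
    \<comment> \<open>The vectors \<open>x + (i/r) w\<close> and \<open>x - (i/r) w\<close> are
      isotropic for the symmetric part, so only their two mixed products survive; \<alpha> measures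
      the skew part.\<close>
    define r where "r = csqrt d"
    have r: "r * r = d" "r \<noteq> 0" using 3 by (simp_all add: r_def power2_eq_square[symmetric])
    define \<alpha> where "\<alpha> = - \<i> * k / r"
    let ?u = "x + (\<i> / r) *s w" and ?v = "x - (\<i> / r) *s w"
    have ind': "indep3 ?u ?v (2 *s y)"
      by (rule indep3_lincombI[OF ind, of _ 1 0 "\<i>/r" _ 1 0 "- \<i>/r" _ 0 2 0])
        (use r in \<open>auto simp: vec_eq_iff field_simps\<close>)
    have q: "m ?u ?u = 0" "m ?v ?v = 0" "m ?u ?v = (1 + \<alpha>) *s (2 *s y)"
      "m ?v ?u = (1 - \<alpha>) *s (2 *s y)" "m ?u (2 *s y) = 0" "m ?v (2 *s y) = 0"
      "m (2 *s y) ?u = 0" "m (2 *s y) ?v = 0" "m (2 *s y) (2 *s y) = 0"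
      using r by (simp_all add: mul_simps p vec_eq_iff \<alpha>_def r(1)[symmetric] field_simps)
    show ?thesis
    proof (cases "\<alpha> = 0")
      case True
      have "algebra_isomorphic (*s) m (*s) A05"
        unfolding table_defs
        by (rule isomorphic_table_multI[OF complex_algebra_axioms ind'])
          (use True in \<open>simp_all only: q\<close>, simp_all add: table_entry_simps)
      then show ?thesis by (rule classifiedI) (simp add: listed_def)
    next
      case False
      have "algebra_isomorphic (*s) m (*s) (A14 \<alpha>)"
        unfolding table_defs
        by (rule isomorphic_table_multI[OF complex_algebra_axioms ind'])
          (simp_all only: q, simp_all add: table_entry_simps)
      then show ?thesis by (rule classifiedI) (use False in \<open>auto simp: listed_def\<close>)
    qed
  qed
qed

lemma left_eigenvalue_0:
  assumes "\<And>x y. m x (m x (m x y)) = 0" "m x v = c *s v" "v \<noteq> 0"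
  shows "c = 0"
proof -
  have "m x (m x (m x v)) = c *s (c *s (c *s v))" by (simp only: assms(2) mul_simps)
  then show ?thesis unfolding assms(1) using assms(3) by simp
qed

text \<open>Semi-alternativity fixes every product except for the scalar in \<open>yx\<close>.
  Nilpotency of left multiplication by \<open>y\<close>, seen on \<open>z\<close>, removes the
  \<open>x\<close> part of \<open>yx\<close>; nilpotency of right multiplication by \<open>x\<close>
  removes the \<open>y\<close> part.\<close>

lemma nil_chain:
  assumes nilL: "\<And>x y. m x (m x (m x y)) = 0" and nilR: "\<And>x y. m (m (m y x) x) x = 0"
    and y: "y = m x x" and z: "z = m x y" and ind: "indep3 x y z"
  obtains c where "m y x = c *s z" "m x z = 0" "m z x = 0" "m y y = 0" "m y z = 0" "m z y = 0"
    "m z z = 0"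
proof -
  have xz: "m x z = 0" unfolding z y by (rule nilL)
  obtain a b c where yx: "m y x = a *s x + b *s y + c *s z" by (rule indep3_span[OF ind])
  have nz: "y \<noteq> 0" "z \<noteq> 0" using indep3_nz[OF ind] by auto
  have s: "m x (m y x) = a *s y + b *s z" "m (m y x) x = 0"
    using nilR[of x x] by (simp_all add: yx mul_simps xz y[symmetric] z[symmetric])
  have 1: "m y y = m z x - (a *s y + b *s z)"
    using cyclic[of x x y] by (simp add: y[symmetric] z[symmetric] xz s mul_simps)
  have 2: "m z x - (a *s y + b *s z) = - m y y"
    using cyclic[of x y x] by (simp add: y[symmetric] z[symmetric] xz s mul_simps)
  have yy: "m y y = 0" using 1 2 vec_eq_neg_iff by metis
  have zx: "m z x = a *s y + b *s z" using 1 yy by simp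
  have "m y z = - a *s z"
    using cyclic[of x x z] by (simp add: y[symmetric] z[symmetric] xz zx mul_simps)
  then have a: "a = 0" and yz: "m y z = 0" using left_eigenvalue_0[OF nilL] nz by fastforce+
  have "m (m (m z x) x) x = b *s (b *s (b *s z))" by (simp add: zx a mul_simps)
  then have b: "b = 0" using nilR[of z x] nz by simp
  have zx: "m z x = 0" using zx a b by simp
  have zy: "m z y = 0"
    using cyclic[of x z x] by (simp add: y[symmetric] z[symmetric] xz zx mul_simps)
  have "m z z = - m z z"
    using cyclic[of z x y] by (simp add: y[symmetric] z[symmetric] xz zx yz mul_simps)
  then have "m z z = 0" using vec_eq_neg_iff by blast
  with that[of c] show ?thesis using yx a b xz zx yy yz zy by simp
qed

text \<open>\<open>x\<close> and \<open>xx\<close> span a plane invariant under the nilpotent left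
  multiplication by \<open>x\<close>, and a nilpotent operator of a plane has square zero.\<close>

lemma nil_short:
  assumes nilL: "\<And>x y. m x (m x (m x y)) = 0" and nz: "m x x \<noteq> 0"
    and dep: "\<not> indep3 x (m x x) (m x (m x x))"
  shows "m x (m x x) = 0" "a *s x + b *s m x x = 0 \<Longrightarrow> a = 0 \<and> b = 0"
proof -
  have x0: "x \<noteq> 0" using nz by (auto simp: mul_simps)
  show ind2: "a = 0 \<and> b = 0" if *: "a *s x + b *s m x x = 0" for a b
  proof -
    have "b = 0"
    proof (rule ccontr)
      assume "b \<noteq> 0"
      then have "m x x = (1 / b) *s (b *s m x x)" by simp
      also have "b *s m x x = - (a *s x)" using * by (metis add.inverse_unique)
      finally have e: "m x x = (- a / b) *s x" by (simp add: vec_eq_iff)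
      then have "- a / b = 0" using left_eigenvalue_0[OF nilL e x0] by simp
      with e nz show False by simp
    qed
    with * x0 show ?thesis by auto
  qed
  obtain a b c where *: "a *s x + b *s m x x + c *s m x (m x x) = 0"
    and n: "a \<noteq> 0 \<or> b \<noteq> 0 \<or> c \<noteq> 0"
    using dep unfolding indep3_def by blast
  have c: "c \<noteq> 0" using ind2[of a b] * n by auto
  define p q where "p = - a / c" and "q = - b / c"
  have "m x (m x x) = (1 / c) *s (c *s m x (m x x))" using c by simp
  also have "c *s m x (m x x) = - (a *s x + b *s m x x)" using * by (metis add.inverse_unique)
  also have "(1 / c) *s \<dots> = p *s x + q *s m x x"
    by (simp add: p_def q_def vec_eq_iff algebra_simps)
  finally have e: "m x (m x x) = p *s x + q *s m x x" .
  have "0 = m x (m x (m x x))" by (rule nilL[symmetric])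
  also have "\<dots> = p *s m x x + q *s m x (m x x)" by (subst e) (simp add: mul_simps)
  also have "\<dots> = (q * p) *s x + (p + q * q) *s m x x"
    unfolding e by (simp add: vec_eq_iff algebra_simps)
  finally have "q * p = 0 \<and> p + q * q = 0" using ind2 by metis
  then have "p = 0 \<and> q = 0" by auto
  with e show "m x (m x x) = 0" by simp
qed

end

lemma (in semi_alternative_vec3) classified_nil:
  assumes nilL: "\<And>x y. m x (m x (m x y)) = 0" and nilR: "\<And>x y. m (m (m y x) x) x = 0"
    and nz: "\<exists>x y. m x y \<noteq> 0"
  shows "classified m"
proof -
  interpret o: semi_alternative_vec3 "\<lambda>x y. m y x" by (rule opposite)
  consider "\<And>x. m x x = 0" | x where "indep3 x (m x x) (m x (m x x))"
    | x where "indep3 x (m x x) (m (m x x) x)"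
    | x where "m x x \<noteq> 0" "\<And>x. \<not> indep3 x (m x x) (m x (m x x))"
      "\<And>x. \<not> indep3 x (m x x) (m (m x x) x)"
    by blast
  then show ?thesis
  proof cases
    case 1
    then show ?thesis using classified_square_zero nz by blast
  next
    case (2 x)
    define y z where "y = m x x" and "z = m x y"
    have ind: "indep3 x y z" using 2 by (simp add: y_def z_def)
    obtain c where p: "m y x = c *s z" "m x z = 0" "m z x = 0" "m y y = 0" "m y z = 0" "m z y = 0"
      "m z z = 0"
      using nil_chain[OF nilL nilR y_def z_def ind] .
    have p': "m x x = y" "m x y = z" by (simp_all add: y_def z_def)
    show ?thesis
    proof (cases "c = 1")
      case True
      have "algebra_isomorphic (*s) m (*s) A06"
        unfolding table_defs
        by (rule isomorphic_table_multI[OF complex_algebra_axioms ind])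
          (simp_all add: table_entry_simps p p' True)
      then show ?thesis by (rule classifiedI) (simp add: listed_def)
    next
      case False
      \<comment> \<open>The parameter solves \<open>(\<alpha> - 1) / (\<alpha> + 1) = c\<close>,
        which has no solution for \<open>c = 1\<close>; the factor of \<open>z\<close> adjusts
        \<open>xy\<close>.\<close>
      have ind': "indep3 x y (((1 - c) / 2) *s z)"
        by (rule indep3_lincombI[OF ind, of _ 1 0 0 _ 0 1 0 _ 0 0 "(1-c)/2"]) (use False in auto)
      have "algebra_isomorphic (*s) m (*s) (S01 ((1 + c) / (1 - c)))"
        unfolding table_defs
        by (rule isomorphic_table_multI[OF complex_algebra_axioms ind'])
          (use False in \<open>simp_all add: table_entry_simps p p' mul_simps vec_eq_iff field_simps\<close>)
      then show ?thesis by (rule classifiedI) (auto simp: listed_def)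
    qed
  next
    case (3 x)
    define y z where "y = m x x" and "z = m y x"
    have ind: "indep3 x y z" using 3 by (simp add: y_def z_def)
    obtain c where p: "m x y = c *s z" "m z x = 0" "m x z = 0" "m y y = 0" "m z y = 0" "m y z = 0"
      "m z z = 0"
      using o.nil_chain[OF nilR nilL y_def z_def ind] .
    have p': "m x x = y" "m y x = z" by (simp_all add: y_def z_def)
    show ?thesis
    proof (cases "c = 1")
      case True
      have "algebra_isomorphic (*s) m (*s) A06"
        unfolding table_defs
        by (rule isomorphic_table_multI[OF complex_algebra_axioms ind])
          (simp_all add: table_entry_simps p p' True)
      then show ?thesis by (rule classifiedI) (simp add: listed_def)
    next
      case False
      \<comment> \<open>Here \<open>z\<close> is \<open>yx\<close>, so the parameter solves the
        mirrored equation \<open>(\<alpha> + 1) / (\<alpha> - 1) = c\<close>.\<close>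
      have ind': "indep3 x y (((c - 1) / 2) *s z)"
        by (rule indep3_lincombI[OF ind, of _ 1 0 0 _ 0 1 0 _ 0 0 "(c-1)/2"]) (use False in auto)
      have "algebra_isomorphic (*s) m (*s) (S01 ((1 + c) / (c - 1)))"
        unfolding table_defs
        by (rule isomorphic_table_multI[OF complex_algebra_axioms ind'])
          (use False in \<open>simp_all add: table_entry_simps p p' mul_simps vec_eq_iff field_simps\<close>)
      then show ?thesis by (rule classifiedI) (auto simp: listed_def)
    qed
  next
    case (4 x)
    have xxx: "m v (m v v) = 0" for v
      using nil_short(1)[OF nilL _ 4(2)] by (cases "m v v = 0") (auto simp: mul_simps)
    have xxx': "m (m v v) v = 0" for v
      using o.nil_short(1)[OF nilR _ 4(3)] by (cases "m v v = 0") (auto simp: mul_simps)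
    have sqsq: "m (m v v) (m v v) = 0" for v
      using cyclic[of v v "m v v"] by (simp add: xxx xxx' mul_simps)
    define y where "y = m x x"
    have y0: "y \<noteq> 0" using 4 by (simp add: y_def)
    obtain w where ind: "indep3 x y w"
      using indep3_extend nil_short(2)[OF nilL 4(1,2)] unfolding y_def by metis
    have p: "m x x = y" "m x y = 0" "m y x = 0" "m y y = 0"
      by (simp_all add: y_def xxx xxx' sqsq)
    obtain a1 b1 c1 where xw: "m x w = a1 *s x + b1 *s y + c1 *s w" by (rule indep3_span[OF ind])
    obtain a2 b2 c2 where wx: "m w x = a2 *s x + b2 *s y + c2 *s w" by (rule indep3_span[OF ind])
    \<comment> \<open>Modulo the span of \<open>x\<close> and \<open>y\<close>, left multiplication
      by \<open>x\<close> scales \<open>w\<close> by \<open>c1\<close>; nilpotency makes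
      \<open>c1\<close> zero, and likewise \<open>c2\<close> on the other side.\<close>
    have "(c1 * c1 * a1) *s x + (c1 * a1 + c1 * c1 * b1) *s y + (c1 * c1 * c1) *s w
      = m x (m x (m x w))"
      by (simp add: xw mul_simps p vec_eq_iff algebra_simps)
    then have "c1 * c1 * c1 = 0" unfolding nilL by (rule indep3D(3)[OF ind])
    then have c1: "c1 = 0" by simp
    have "(c2 * c2 * a2) *s x + (c2 * a2 + c2 * c2 * b2) *s y + (c2 * c2 * c2) *s w
      = m (m (m w x) x) x"
      by (simp add: wx mul_simps p vec_eq_iff algebra_simps)
    then have "c2 * c2 * c2 = 0" unfolding nilR by (rule indep3D(3)[OF ind])
    then have c2: "c2 = 0" by simp
    have yw: "m y w = (2 * a1 - a2) *s y"
      using cyclic[of x x w] by (simp add: xw wx c1 c2 p mul_simps vec_eq_iff algebra_simps)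
    have wy: "m w y = (2 * a2 - a1) *s y"
      using cyclic[of x w x] by (simp add: xw wx c1 c2 p mul_simps vec_eq_iff algebra_simps)
    have "2 * a1 - a2 = 0" using o.left_eigenvalue_0[OF nilR yw y0] .
    moreover have "2 * a2 - a1 = 0" using left_eigenvalue_0[OF nilL wy y0] .
    ultimately have a: "a1 = 0" "a2 = 0" by algebra+
    have p2: "m y w = 0" "m w y = 0" "m x w = b1 *s y" "m w x = b2 *s y"
      using xw wx yw wy by (simp_all add: a c1 c2)
    obtain a b c where ww: "m w w = a *s x + b *s y + c *s w" by (rule indep3_span[OF ind])
    have "(c * a) *s x + (a * b2 + c * b) *s y + (c * c) *s w = m w (m w w)"
      by (simp add: ww mul_simps p p2 vec_eq_iff algebra_simps)
    then have "c * c = 0" unfolding xxx by (rule indep3D(3)[OF ind])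
    then have c: "c = 0" by simp
    have "(a * a) *s y = m (m w w) (m w w)"
      by (simp add: ww c mul_simps p p2)
    then have a: "a = 0" using sqsq y0 by simp
    have ww: "m w w = b *s y" using ww a c by simp
    \<comment> \<open>Subtracting \<open>s x\<close> from \<open>w\<close> makes \<open>x\<close>
      and \<open>w\<close> orthogonal for the symmetric part of the form.\<close>
    define s where "s = (b1 + b2) / 2"
    have ind': "indep3 x y (w - s *s x)"
      by (rule indep3_lincombI[OF ind, of _ 1 0 0 _ 0 1 0 _ "-s" 0 1]) (simp_all add: vec_eq_iff)
    show ?thesis
      by (rule classified_form[OF ind', of "(b1 - b2) / 2" "b - s * s"])
        (simp_all add: p p2 ww mul_simps s_def vec_eq_iff field_simps)
  qed
qed

section \<open>Classification inside three families of tables\<close>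

definition vec3 :: "complex \<Rightarrow> complex \<Rightarrow> complex \<Rightarrow> complex^3" where
  "vec3 a b c = a *s e1 + b *s e2 + c *s e3"

lemma indep3_axis: "indep3 e1 e2 e3"
  unfolding indep3_def by (simp add: vec_eq_iff forall_3 axis_def)

lemma indep3_vec3 [simp]:
  assumes "a1 * (b2 * c3 - b3 * c2) - a2 * (b1 * c3 - b3 * c1) + a3 * (b1 * c2 - b2 * c1) \<noteq> 0"
  shows "indep3 (vec3 a1 a2 a3) (vec3 b1 b2 b3) (vec3 c1 c2 c3)"
  unfolding vec3_def by (rule indep3_lincombI[OF indep3_axis refl refl refl assms])

lemma vec3_nth [simp]: "vec3 a b c $ 1 = a" "vec3 a b c $ 2 = b" "vec3 a b c $ 3 = c"
  by (simp_all add: vec3_def axis_def)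

text \<open>The nine parameters are, row by row, the coordinates in the given table of the vectors
  that become \<open>e1, e2, e3\<close> of the target.\<close>

lemmas isomorphic_tablesI = isomorphic_table_multI[OF complex_algebra_table_mult,
    of "vec3 a1 a2 a3" "vec3 b1 b2 b3" "vec3 c1 c2 c3" for a1 a2 a3 b1 b2 b3 c1 c2 c3]

lemma classified_iso:
  assumes "algebra_isomorphic (*s) m (*s) m'" "classified m'"
  shows "classified m"
  using assms algebra_isomorphic_trans unfolding classified_def by blast

lemmas tables_simps = lincomb3_def table_mult_simps

section \<open>Tables whose kernel has zero multiplication\<close>

text \<open>In each family below, \<open>e1\<close> has value 1 under a character whose kernel is spanned by \<open>e2\<close> and
  \<open>e3\<close>. Here the kernel has zero multiplication and splits into joint eigenvectors of left and
  right multiplication by \<open>e1\<close>.\<close>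

definition peirce_mult ::
  "complex \<Rightarrow> complex \<Rightarrow> complex \<Rightarrow> complex \<Rightarrow> complex \<Rightarrow> complex \<Rightarrow> complex^3 \<Rightarrow> complex^3 \<Rightarrow> complex^3"
  where "peirce_mult n1 n2 l1 r1 l2 r2 = table_mult [((1,1), e1 + n1 *s e2 + n2 *s e3),
    ((1,2), l1 *s e2), ((2,1), r1 *s e2), ((1,3), l2 *s e3), ((3,1), r2 *s e3)]"

lemma peirce_mult_swap:
  "algebra_isomorphic (*s) (peirce_mult n1 n2 l1 r1 l2 r2) (*s) (peirce_mult n2 n1 l2 r2 l1 r1)"
  unfolding peirce_mult_def
  by (rule isomorphic_tablesI[of 1 0 0 0 0 1 0 1 0]) (simp_all add: tables_simps)

text \<open>The digits in these names are \<open>l1 r1\<close> and \<open>l2 r2\<close>. The square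
  of \<open>e1 + c e2\<close> has \<open>e2\<close> coordinate \<open>n1 + (l1 + r1) c\<close>,
  which equals \<open>c\<close> for \<open>c = - n1\<close> in type 11 and \<open>c = n1\<close> in
  type 00. In types 10 and 01 no \<open>c\<close> absorbs a nonzero \<open>n1\<close>.\<close>

lemma classified_peirce_mult_11_11: "classified (peirce_mult n1 n2 1 1 1 1)"
proof -
  have "algebra_isomorphic (*s) (peirce_mult n1 n2 1 1 1 1) (*s) A09"
    unfolding peirce_mult_def table_defs
    by (rule isomorphic_tablesI[of 1 "-n1" "-n2" 0 1 0 0 0 1])
      (simp_all add: tables_simps algebra_simps)
  then show ?thesis by (rule classifiedI) (simp add: listed_def)
qed

lemma classified_peirce_mult_11_00: "classified (peirce_mult n1 n2 1 1 0 0)"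
proof -
  have "algebra_isomorphic (*s) (peirce_mult n1 n2 1 1 0 0) (*s) A02"
    unfolding peirce_mult_def table_defs
    by (rule isomorphic_tablesI[of 1 "-n1" n2 0 1 0 0 0 1])
      (simp_all add: tables_simps algebra_simps)
  then show ?thesis by (rule classifiedI) (simp add: listed_def)
qed

lemma classified_peirce_mult_00_00: "classified (peirce_mult n1 n2 0 0 0 0)"
proof -
  have "algebra_isomorphic (*s) (peirce_mult n1 n2 0 0 0 0) (*s) A03"
    unfolding peirce_mult_def table_defs
    by (rule isomorphic_tablesI[of 1 n1 n2 0 1 0 0 0 1])
      (simp_all add: tables_simps algebra_simps)
  then show ?thesis by (rule classifiedI) (simp add: listed_def)
qed

text \<open>With \<open>n = n1 e2 + n2 e3\<close>, the square of \<open>2 e1\<close> is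
  \<open>2 (2 e1) + 4 n\<close>. Both lines have the same eigenvalues, so a nonzero
  \<open>4 n\<close> can serve as a basis vector. This is the origin of the constants 2 and 4 here
  and below.\<close>

lemma classified_peirce_mult_10_10: "classified (peirce_mult n1 n2 1 0 1 0)"
proof -
  consider "n1 = 0 \<and> n2 = 0" | "n1 \<noteq> 0" | "n2 \<noteq> 0" by blast
  then show ?thesis
  proof cases
    case 1
    have "algebra_isomorphic (*s) (peirce_mult n1 n2 1 0 1 0) (*s) A17"
      unfolding peirce_mult_def table_defs
      by (rule isomorphic_tablesI[of 1 0 0 0 1 0 0 0 1])
        (use 1 in \<open>simp_all add: tables_simps algebra_simps\<close>)
    then show ?thesis by (rule classifiedI) (simp add: listed_def)
  next
    case 2
    have "algebra_isomorphic (*s) (peirce_mult n1 n2 1 0 1 0) (*s) S12"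
      unfolding peirce_mult_def table_defs
      by (rule isomorphic_tablesI[of 2 0 0 0 "4*n1" "4*n2" 0 0 1])
        (use 2 in \<open>simp_all add: tables_simps algebra_simps\<close>)
    then show ?thesis by (rule classifiedI) (simp add: listed_def)
  next
    case 3
    have "algebra_isomorphic (*s) (peirce_mult n1 n2 1 0 1 0) (*s) S12"
      unfolding peirce_mult_def table_defs
      by (rule isomorphic_tablesI[of 2 0 0 0 "4*n1" "4*n2" 0 1 0])
        (use 3 in \<open>simp_all add: tables_simps algebra_simps\<close>)
    then show ?thesis by (rule classifiedI) (simp add: listed_def)
  qed
qed

lemma classified_peirce_mult_01_01: "classified (peirce_mult n1 n2 0 1 0 1)"
proof -
  consider "n1 = 0 \<and> n2 = 0" | "n1 \<noteq> 0" | "n2 \<noteq> 0" by blast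
  then show ?thesis
  proof cases
    case 1
    have "algebra_isomorphic (*s) (peirce_mult n1 n2 0 1 0 1) (*s) A18"
      unfolding peirce_mult_def table_defs
      by (rule isomorphic_tablesI[of 1 0 0 0 1 0 0 0 1])
        (use 1 in \<open>simp_all add: tables_simps algebra_simps\<close>)
    then show ?thesis by (rule classifiedI) (simp add: listed_def)
  next
    case 2
    have "algebra_isomorphic (*s) (peirce_mult n1 n2 0 1 0 1) (*s) S13"
      unfolding peirce_mult_def table_defs
      by (rule isomorphic_tablesI[of 2 0 0 0 "4*n1" "4*n2" 0 0 1])
        (use 2 in \<open>simp_all add: tables_simps algebra_simps\<close>)
    then show ?thesis by (rule classifiedI) (simp add: listed_def)
  next
    case 3
    have "algebra_isomorphic (*s) (peirce_mult n1 n2 0 1 0 1) (*s) S13"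
      unfolding peirce_mult_def table_defs
      by (rule isomorphic_tablesI[of 2 0 0 0 "4*n1" "4*n2" 0 1 0])
        (use 3 in \<open>simp_all add: tables_simps algebra_simps\<close>)
    then show ?thesis by (rule classifiedI) (simp add: listed_def)
  qed
qed

lemma classified_peirce_mult_10_01: "classified (peirce_mult n1 n2 1 0 0 1)"
proof -
  consider "n1 = 0 \<and> n2 = 0" | "n1 \<noteq> 0 \<and> n2 = 0" | "n1 = 0 \<and> n2 \<noteq> 0" | "n1 \<noteq> 0 \<and> n2 \<noteq> 0" by blast
  then show ?thesis
  proof cases
    case 1
    have "algebra_isomorphic (*s) (peirce_mult n1 n2 1 0 0 1) (*s) A19"
      unfolding peirce_mult_def table_defs
      by (rule isomorphic_tablesI[of 1 0 0 0 0 1 0 1 0])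
        (use 1 in \<open>simp_all add: tables_simps algebra_simps\<close>)
    then show ?thesis by (rule classifiedI) (simp add: listed_def)
  next
    case 2
    have "algebra_isomorphic (*s) (peirce_mult n1 n2 1 0 0 1) (*s) S02"
      unfolding peirce_mult_def table_defs
      by (rule isomorphic_tablesI[of 2 0 0 0 "4*n1" 0 0 0 1])
        (use 2 in \<open>simp_all add: tables_simps algebra_simps\<close>)
    then show ?thesis by (rule classifiedI) (simp add: listed_def)
  next
    case 3
    have "algebra_isomorphic (*s) (peirce_mult n1 n2 1 0 0 1) (*s) S04"
      unfolding peirce_mult_def table_defs
      by (rule isomorphic_tablesI[of 2 0 0 0 1 0 0 0 "4*n2"])
        (use 3 in \<open>simp_all add: tables_simps algebra_simps\<close>)
    then show ?thesis by (rule classifiedI) (simp add: listed_def)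
  next
    case 4
    have "algebra_isomorphic (*s) (peirce_mult n1 n2 1 0 0 1) (*s) S03"
      unfolding peirce_mult_def table_defs
      by (rule isomorphic_tablesI[of 2 0 0 0 "4*n1" 0 0 0 "4*n2"])
        (use 4 in \<open>simp_all add: tables_simps algebra_simps\<close>)
    then show ?thesis by (rule classifiedI) (simp add: listed_def)
  qed
qed

lemma classified_peirce_mult_11_10: "classified (peirce_mult n1 n2 1 1 1 0)"
proof -
  consider "n2 = 0" | "n2 \<noteq> 0" by blast
  then show ?thesis
  proof cases
    case 1
    have "algebra_isomorphic (*s) (peirce_mult n1 n2 1 1 1 0) (*s) A15"
      unfolding peirce_mult_def table_defs
      by (rule isomorphic_tablesI[of 1 "-n1" 0 0 0 1 0 1 0])
        (use 1 in \<open>simp_all add: tables_simps algebra_simps\<close>)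
    then show ?thesis by (rule classifiedI) (simp add: listed_def)
  next
    case 2
    have "algebra_isomorphic (*s) (peirce_mult n1 n2 1 1 1 0) (*s) S08"
      unfolding peirce_mult_def table_defs
      by (rule isomorphic_tablesI[of 2 "-2*n1" 0 0 0 "4*n2" 0 1 0])
        (use 2 in \<open>simp_all add: tables_simps algebra_simps\<close>)
    then show ?thesis by (rule classifiedI) (simp add: listed_def)
  qed
qed

lemma classified_peirce_mult_11_01: "classified (peirce_mult n1 n2 1 1 0 1)"
proof -
  consider "n2 = 0" | "n2 \<noteq> 0" by blast
  then show ?thesis
  proof cases
    case 1
    have "algebra_isomorphic (*s) (peirce_mult n1 n2 1 1 0 1) (*s) A16"
      unfolding peirce_mult_def table_defs
      by (rule isomorphic_tablesI[of 1 "-n1" 0 0 0 1 0 1 0])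
        (use 1 in \<open>simp_all add: tables_simps algebra_simps\<close>)
    then show ?thesis by (rule classifiedI) (simp add: listed_def)
  next
    case 2
    have "algebra_isomorphic (*s) (peirce_mult n1 n2 1 1 0 1) (*s) S05"
      unfolding peirce_mult_def table_defs
      by (rule isomorphic_tablesI[of 2 "-2*n1" 0 0 0 "4*n2" 0 1 0])
        (use 2 in \<open>simp_all add: tables_simps algebra_simps\<close>)
    then show ?thesis by (rule classifiedI) (simp add: listed_def)
  qed
qed

lemma classified_peirce_mult_00_10: "classified (peirce_mult n1 n2 0 0 1 0)"
proof -
  consider "n2 = 0" | "n2 \<noteq> 0" by blast
  then show ?thesis
  proof cases
    case 1
    have "algebra_isomorphic (*s) (peirce_mult n1 n2 0 0 1 0) (*s) A22"
      unfolding peirce_mult_def table_defs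
      by (rule isomorphic_tablesI[of 1 "n1" 0 0 0 1 0 1 0])
        (use 1 in \<open>simp_all add: tables_simps algebra_simps\<close>)
    then show ?thesis by (rule classifiedI) (simp add: listed_def)
  next
    case 2
    have "algebra_isomorphic (*s) (peirce_mult n1 n2 0 0 1 0) (*s) S10"
      unfolding peirce_mult_def table_defs
      by (rule isomorphic_tablesI[of 2 "2*n1" 0 0 0 "4*n2" 0 1 0])
        (use 2 in \<open>simp_all add: tables_simps algebra_simps\<close>)
    then show ?thesis by (rule classifiedI) (simp add: listed_def)
  qed
qed

lemma classified_peirce_mult_00_01: "classified (peirce_mult n1 n2 0 0 0 1)"
proof -
  consider "n2 = 0" | "n2 \<noteq> 0" by blast
  then show ?thesis
  proof cases
    case 1
    have "algebra_isomorphic (*s) (peirce_mult n1 n2 0 0 0 1) (*s) A21"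
      unfolding peirce_mult_def table_defs
      by (rule isomorphic_tablesI[of 1 "n1" 0 0 0 1 0 1 0])
        (use 1 in \<open>simp_all add: tables_simps algebra_simps\<close>)
    then show ?thesis by (rule classifiedI) (simp add: listed_def)
  next
    case 2
    have "algebra_isomorphic (*s) (peirce_mult n1 n2 0 0 0 1) (*s) S07"
      unfolding peirce_mult_def table_defs
      by (rule isomorphic_tablesI[of 2 "2*n1" 0 0 0 "4*n2" 0 1 0])
        (use 2 in \<open>simp_all add: tables_simps algebra_simps\<close>)
    then show ?thesis by (rule classifiedI) (simp add: listed_def)
  qed
qed

text \<open>Up to exchanging the two eigenlines, ten of the sixteen patterns remain.\<close>

lemma classified_peirce_mult:
  assumes "l1 \<in> {0, 1}" "r1 \<in> {0, 1}" "l2 \<in> {0, 1}" "r2 \<in> {0, 1}"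
  shows "classified (peirce_mult n1 n2 l1 r1 l2 r2)"
proof -
  note c = classified_peirce_mult_11_11 classified_peirce_mult_11_00 classified_peirce_mult_00_00
    classified_peirce_mult_10_10 classified_peirce_mult_01_01 classified_peirce_mult_10_01
    classified_peirce_mult_11_10 classified_peirce_mult_11_01 classified_peirce_mult_00_10
    classified_peirce_mult_00_01
  show ?thesis
    using assms c c[THEN classified_iso[OF peirce_mult_swap]] by auto
qed

text \<open>Coordinate form for extracting scalar relations between table parameters: each use names
  a triple of basis vectors and the coordinate to compare.\<close>

lemma (in semi_alternative_vec3) cyclic_nth:
  "(m (m x y) z - m x (m y z) - (m (m y z) x - m y (m z x))) $ i = 0"
  using cyclic[of x y z] by simp

section \<open>Tables with two orthogonal idempotents modulo a line\<close>

text \<open>Modulo the ideal spanned by \<open>e3\<close>, \<open>e1\<close> and \<open>e2\<close> are orthogonal idempotents.\<close>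

definition two_characters_mult ::
  "complex \<Rightarrow> complex \<Rightarrow> complex \<Rightarrow> complex \<Rightarrow> complex \<Rightarrow> complex \<Rightarrow> complex \<Rightarrow> complex \<Rightarrow> complex \<Rightarrow>
    complex^3 \<Rightarrow> complex^3 \<Rightarrow> complex^3"
  where "two_characters_mult a b c d p q r s t = table_mult [((1,1), e1 + a *s e3),
    ((2,2), e2 + b *s e3), ((1,2), c *s e3), ((2,1), d *s e3), ((1,3), p *s e3),
    ((3,1), q *s e3), ((2,3), r *s e3), ((3,2), s *s e3), ((3,3), t *s e3)]"

lemma two_characters_mult_swap:
  "algebra_isomorphic (*s) (two_characters_mult a b c d p q r s t)
    (*s) (two_characters_mult b a d c r s p q t)"
  unfolding two_characters_mult_def
  by (rule isomorphic_tablesI[of 0 1 0 1 0 0 0 0 1]) (simp_all add: tables_simps)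

lemma two_characters_mult_relations:
  assumes "semi_alternative_vec3 (two_characters_mult a b c d p q r s t)"
  shows "p + a * t - p * p = 0" "q + a * t - q * q = 0" "r + b * t - r * r = 0"
    "s + b * t - s * s = 0" "q * t - p * t = 0" "s * t - r * t = 0" "c * t - r * p = 0"
    "c * t - q * s = 0" "d * t - p * r = 0" "(c + a * s - p * c) - (c * q - p * d) = 0"
    "(c * q - p * d) - (d * q - d - r * a) = 0" "(d + b * q - r * d) - (d * s - r * c) = 0"
    "(d * s - r * c) - (c * s - c - p * b) = 0"
proof -
  interpret semi_alternative_vec3 "two_characters_mult a b c d p q r s t" by fact
  note sm = two_characters_mult_def table_mult_simps algebra_simps
  show "p + a * t - p * p = 0"
    by (rule trans[OF _ cyclic_nth[of e1 e1 e3 3]]) (simp add: sm)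
  show "q + a * t - q * q = 0"
    by (rule trans[OF _ cyclic_nth[of e1 e3 e1 3]]) (simp add: sm)
  show "r + b * t - r * r = 0"
    by (rule trans[OF _ cyclic_nth[of e2 e2 e3 3]]) (simp add: sm)
  show "s + b * t - s * s = 0"
    by (rule trans[OF _ cyclic_nth[of e2 e3 e2 3]]) (simp add: sm)
  show "q * t - p * t = 0"
    by (rule trans[OF _ cyclic_nth[of e3 e1 e3 3]]) (simp add: sm)
  show "s * t - r * t = 0"
    by (rule trans[OF _ cyclic_nth[of e3 e2 e3 3]]) (simp add: sm)
  show "c * t - r * p = 0"
    by (rule trans[OF _ cyclic_nth[of e1 e2 e3 3]]) (simp add: sm)
  show "c * t - q * s = 0"
    by (rule trans[OF _ cyclic_nth[of e2 e3 e1 3]]) (simp add: sm)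
  show "d * t - p * r = 0"
    by (rule trans[OF _ cyclic_nth[of e2 e1 e3 3]]) (simp add: sm)
  show "(c + a * s - p * c) - (c * q - p * d) = 0"
    by (rule trans[OF _ cyclic_nth[of e1 e1 e2 3]]) (simp add: sm)
  show "(c * q - p * d) - (d * q - d - r * a) = 0"
    by (rule trans[OF _ cyclic_nth[of e1 e2 e1 3]]) (simp add: sm)
  show "(d + b * q - r * d) - (d * s - r * c) = 0"
    by (rule trans[OF _ cyclic_nth[of e2 e2 e1 3]]) (simp add: sm)
  show "(d * s - r * c) - (c * s - c - p * b) = 0"
    by (rule trans[OF _ cyclic_nth[of e2 e1 e2 3]]) (simp add: sm)
qed

lemma classified_two_characters_mult_idempotent:
  assumes "t \<noteq> 0"
  shows "classified (two_characters_mult 0 0 0 0 0 0 0 0 t)"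
proof -
  have "algebra_isomorphic (*s) (two_characters_mult 0 0 0 0 0 0 0 0 t) (*s) A07"
    unfolding two_characters_mult_def table_defs
    by (rule isomorphic_tablesI[of 1 0 0 0 1 0 0 0 "1/t"])
      (use assms in \<open>simp_all add: tables_simps algebra_simps\<close>)
  then show ?thesis by (rule classifiedI) (simp add: listed_def)
qed

text \<open>The digits are the values of \<open>p, q, r, s\<close>, the eigenvalues of
  \<open>e1\<close> and \<open>e2\<close> on \<open>e3\<close> from the left and from the right. As
  in the Peirce tables, a shift along \<open>e3\<close> produces an idempotent when the two
  eigenvalues agree.\<close>

lemma classified_two_characters_mult_0000:
  "classified (two_characters_mult a b 0 0 0 0 0 0 0)"
proof -
  have "algebra_isomorphic (*s) (two_characters_mult a b 0 0 0 0 0 0 0) (*s) A01"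
    unfolding two_characters_mult_def table_defs
    by (rule isomorphic_tablesI[of 1 0 a 0 1 b 0 0 1])
      (simp_all add: tables_simps algebra_simps)
  then show ?thesis by (rule classifiedI) (simp add: listed_def)
qed

lemma classified_two_characters_mult_1100:
  "classified (two_characters_mult a b (-b) (-b) 1 1 0 0 0)"
proof -
  have "algebra_isomorphic (*s) (two_characters_mult a b (-b) (-b) 1 1 0 0 0) (*s) A08"
    unfolding two_characters_mult_def table_defs
    by (rule isomorphic_tablesI[of 0 1 b 1 0 "-a" 0 0 1])
      (simp_all add: tables_simps algebra_simps)
  then show ?thesis by (rule classifiedI) (simp add: listed_def)
qed

lemma classified_two_characters_mult_1001: "classified (two_characters_mult a a c (-a) 1 0 0 1 0)"
proof (cases "a = 0")
  case True
  have "algebra_isomorphic (*s) (two_characters_mult a a c (-a) 1 0 0 1 0) (*s) A20"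
    unfolding two_characters_mult_def table_defs
    by (rule isomorphic_tablesI[of 1 0 "-c" 0 1 0 0 0 1])
      (use True in \<open>simp_all add: tables_simps algebra_simps\<close>)
  then show ?thesis by (rule classifiedI) (simp add: listed_def)
next
  case False
  have "algebra_isomorphic (*s) (two_characters_mult a a c (-a) 1 0 0 1 0) (*s) S11"
    unfolding two_characters_mult_def table_defs
    \<comment> \<open>The third vector is the unit element. The first is the difference of the two
      idempotents modulo \<open>e3\<close>, and its square is the unit plus
      \<open>4 a e3\<close>.\<close>
    by (rule isomorphic_tablesI[of 1 "-1" "-c" 0 0 "4*a" 1 1 "-a-c"])
      (use False in \<open>simp_all add: tables_simps algebra_simps\<close>)
  then show ?thesis by (rule classifiedI) (simp add: listed_def)
qed

lemma classified_two_characters_mult_1000: "classified (two_characters_mult a b (-b) 0 1 0 0 0 0)"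
proof (cases "a = 0")
  case True
  have "algebra_isomorphic (*s) (two_characters_mult a b (-b) 0 1 0 0 0 0) (*s) A23"
    unfolding two_characters_mult_def table_defs
    by (rule isomorphic_tablesI[of 1 0 0 0 1 b 0 0 1])
      (use True in \<open>simp_all add: tables_simps algebra_simps\<close>)
  then show ?thesis by (rule classifiedI) (simp add: listed_def)
next
  case False
  have "algebra_isomorphic (*s) (two_characters_mult a b (-b) 0 1 0 0 0 0) (*s) S09"
    unfolding two_characters_mult_def table_defs
    by (rule isomorphic_tablesI[of 2 0 0 0 0 "4*a" 0 1 b])
      (use False in \<open>simp_all add: tables_simps algebra_simps\<close>)
  then show ?thesis by (rule classifiedI) (simp add: listed_def)
qed

lemma classified_two_characters_mult_0100: "classified (two_characters_mult a b 0 (-b) 0 1 0 0 0)"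
proof (cases "a = 0")
  case True
  have "algebra_isomorphic (*s) (two_characters_mult a b 0 (-b) 0 1 0 0 0) (*s) A24"
    unfolding two_characters_mult_def table_defs
    by (rule isomorphic_tablesI[of 1 0 0 0 1 b 0 0 1])
      (use True in \<open>simp_all add: tables_simps algebra_simps\<close>)
  then show ?thesis by (rule classifiedI) (simp add: listed_def)
next
  case False
  have "algebra_isomorphic (*s) (two_characters_mult a b 0 (-b) 0 1 0 0 0) (*s) S06"
    unfolding two_characters_mult_def table_defs
    by (rule isomorphic_tablesI[of 2 0 0 0 0 "4*a" 0 1 b])
      (use False in \<open>simp_all add: tables_simps algebra_simps\<close>)
  then show ?thesis by (rule classifiedI) (simp add: listed_def)
qed

text \<open>For nonzero \<open>t\<close>, subtracting the multiples \<open>p / t\<close> and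
  \<open>r / t\<close> of \<open>e3\<close> makes \<open>e1\<close> and \<open>e2\<close> annihilate
  \<open>e3\<close>; the hypotheses say that all other corrections disappear with it.\<close>

lemma two_characters_mult_shift:
  assumes "t \<noteq> 0" "p + a * t - p * p = 0" "r + b * t - r * r = 0" "c * t - r * p = 0" "d * t - p * r = 0"
  shows "algebra_isomorphic (*s) (two_characters_mult a b c d p p r r t)
    (*s) (two_characters_mult 0 0 0 0 0 0 0 0 t)"
proof -
  have *: "a = (p * p - p) / t" "b = (r * r - r) / t" "c = r * p / t" "d = r * p / t"
    using assms by (simp_all add: field_simps)
  show ?thesis
    unfolding two_characters_mult_def *
    by (rule isomorphic_tablesI[of 1 0 "- p / t" 0 1 "- r / t" 0 0 1])
      (use assms(1) in \<open>simp_all add: tables_simps field_simps\<close>)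
qed

lemma classified_two_characters_mult:
  assumes "semi_alternative_vec3 (two_characters_mult a b c d p q r s t)"
  shows "classified (two_characters_mult a b c d p q r s t)"
proof (cases "t = 0")
  case False
  note rel = two_characters_mult_relations[OF assms]
  have "p = q" "r = s" using rel(5,6) False by auto
  then show ?thesis
    using two_characters_mult_shift[OF False rel(1,3,7,9)]
      classified_two_characters_mult_idempotent[OF False] classified_iso by blast
next
  case True
  note rel = two_characters_mult_relations[OF assms, unfolded True, simplified]
  have "p * (1 - p) = 0" "q * (1 - q) = 0" "r * (1 - r) = 0" "s * (1 - s) = 0"
    using rel by (simp_all add: algebra_simps)
  then have 01: "p = 0 \<or> p = 1" "q = 0 \<or> q = 1" "r = 0 \<or> r = 1" "s = 0 \<or> s = 1"
    by auto
  note c = classified_two_characters_mult_0000 classified_two_characters_mult_1100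
    classified_two_characters_mult_1001 classified_two_characters_mult_1000
    classified_two_characters_mult_0100
  have "r * p = 0" "q * s = 0" using two_characters_mult_relations[OF assms] True by auto
  \<comment> \<open>Three choices for \<open>p, r\<close> and three for \<open>q, s\<close>; the
    last four of the nine cases are earlier ones with \<open>e1\<close> and \<open>e2\<close>
    exchanged.\<close>
  then consider "p = 0" "q = 0" "r = 0" "s = 0" | "p = 1" "q = 1" "r = 0" "s = 0"
    | "p = 1" "q = 0" "r = 0" "s = 1" | "p = 1" "q = 0" "r = 0" "s = 0"
    | "p = 0" "q = 1" "r = 0" "s = 0" | "p = 0" "q = 0" "r = 1" "s = 1"
    | "p = 0" "q = 1" "r = 1" "s = 0" | "p = 0" "q = 0" "r = 1" "s = 0"
    | "p = 0" "q = 0" "r = 0" "s = 1"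
    using 01 by auto
  then show ?thesis
  proof cases
    case 1
    have "c = 0" "d = 0" using two_characters_mult_relations(10-13)[OF assms] unfolding 1 by algebra+
    then show ?thesis using 1 True c(1) by simp
  next
    case 2
    have "c = - b" "d = - b" using two_characters_mult_relations(10-13)[OF assms] unfolding 2 by algebra+
    then show ?thesis using 2 True c(2) by simp
  next
    case 3
    have "d = - a" "b = a" using two_characters_mult_relations(10-13)[OF assms] unfolding 3 by algebra+
    then show ?thesis using 3 True c(3) by simp
  next
    case 4
    have "c = - b" "d = 0" using two_characters_mult_relations(10-13)[OF assms] unfolding 4 by algebra+
    then show ?thesis using 4 True c(4) by simp
  next
    case 5
    have "c = 0" "d = - b" using two_characters_mult_relations(10-13)[OF assms] unfolding 5 by algebra+
    then show ?thesis using 5 True c(5) by simp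
  next
    case 6
    have "c = - a" "d = - a" using two_characters_mult_relations(10-13)[OF assms] unfolding 6 by algebra+
    then show ?thesis using 6 True c(2)[THEN classified_iso[OF two_characters_mult_swap]] by simp
  next
    case 7
    have "c = - b" "a = b" using two_characters_mult_relations(10-13)[OF assms] unfolding 7 by algebra+
    then show ?thesis using 7 True c(3)[THEN classified_iso[OF two_characters_mult_swap]] by simp
  next
    case 8
    have "d = - a" "c = 0" using two_characters_mult_relations(10-13)[OF assms] unfolding 8 by algebra+
    then show ?thesis using 8 True c(4)[THEN classified_iso[OF two_characters_mult_swap]] by simp
  next
    case 9
    have "d = 0" "c = - a" using two_characters_mult_relations(10-13)[OF assms] unfolding 9 by algebra+
    then show ?thesis using 9 True c(5)[THEN classified_iso[OF two_characters_mult_swap]] by simp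
  qed
qed

section \<open>Tables whose kernel is spanned by a vector and its square\<close>

definition nil_extension_mult ::
  "complex \<Rightarrow> complex \<Rightarrow> complex \<Rightarrow> complex \<Rightarrow> complex \<Rightarrow> complex \<Rightarrow> complex \<Rightarrow> complex \<Rightarrow> complex \<Rightarrow>
    complex \<Rightarrow> complex^3 \<Rightarrow> complex^3 \<Rightarrow> complex^3"
  where "nil_extension_mult n1 n2 l1 l2 m1 m2 r1 r2 s1 s2 = table_mult [
    ((1,1), e1 + n1 *s e2 + n2 *s e3), ((2,2), e3), ((1,2), l1 *s e2 + l2 *s e3),
    ((1,3), m1 *s e2 + m2 *s e3), ((2,1), r1 *s e2 + r2 *s e3), ((3,1), s1 *s e2 + s2 *s e3)]"

text \<open>As \<open>e3\<close> is the square of \<open>e2\<close>, the eigenvalues on it are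
  \<open>m2 = 2 l1 - r1\<close> and \<open>s2 = 2 r1 - l1\<close>. All four are 0 or 1, which forces
  them to be equal; the algebra turns out to be commutative.\<close>

lemma nil_extension_mult_relations:
  assumes "semi_alternative_vec3 (nil_extension_mult n1 n2 l1 l2 m1 m2 r1 r2 s1 s2)"
  shows "m1 = 0" "s1 = 0" "l1 = m2" "r1 = m2" "s2 = m2" "m2 = 0 \<or> m2 = 1" "r2 = l2"
    "n1 = (2 * m2 - 1) * l2"
proof -
  interpret semi_alternative_vec3 "nil_extension_mult n1 n2 l1 l2 m1 m2 r1 r2 s1 s2" by fact
  note sm = nil_extension_mult_def table_mult_simps algebra_simps
  have 1: "- m1 - s1 = 0"
    by (rule trans[OF _ cyclic_nth[of e1 e2 e2 2]]) (simp add: sm)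
  have 2: "s1 = 0"
    by (rule trans[OF _ cyclic_nth[of e2 e2 e1 2]]) (simp add: sm)
  show z: "s1 = 0" "m1 = 0" using 1 2 by simp_all
  have 3: "l1 - m2 - s2 + r1 = 0"
    by (rule trans[OF _ cyclic_nth[of e1 e2 e2 3]]) (simp add: sm)
  have 4: "s2 - r1 - r1 + l1 = 0"
    by (rule trans[OF _ cyclic_nth[of e2 e2 e1 3]]) (simp add: sm)
  have 5: "l1 - l1 * l1 = 0"
    by (rule trans[OF _ cyclic_nth[of e1 e1 e2 2]]) (simp add: sm z)
  have 6: "r1 - r1 * r1 = 0"
    by (rule trans[OF _ cyclic_nth[of e1 e2 e1 2]]) (simp add: sm z)
  have 7: "m2 - m2 * m2 = 0"
    by (rule trans[OF _ cyclic_nth[of e1 e1 e3 3]]) (simp add: sm z)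
  have 8: "s2 - s2 * s2 = 0"
    by (rule trans[OF _ cyclic_nth[of e1 e3 e1 3]]) (simp add: sm z)
  have 9: "l2 + n1 - l1 * l2 - l2 * m2 - (l1 * r2 + l2 * s2 - r1 * l2 - r2 * m2) = 0"
    by (rule trans[OF _ cyclic_nth[of e1 e1 e2 3]]) (simp add: sm z)
  have 10: "(l1 * r2 + l2 * s2 - r1 * l2 - r2 * m2) - (r1 * r2 + r2 * s2 - r2 - n1) = 0"
    by (rule trans[OF _ cyclic_nth[of e1 e2 e1 3]]) (simp add: sm z)
  have "l1 * (1 - l1) = 0" "r1 * (1 - r1) = 0" using 5 6 by (simp_all add: algebra_simps)
  then have 01: "l1 = 0 \<or> l1 = 1" "r1 = 0 \<or> r1 = 1" by auto
  have m2: "m2 = 2 * l1 - r1" and s2: "s2 = 2 * r1 - l1" using 3 4 by algebra+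
  have lr: "l1 = r1" using 01 7 8 unfolding m2 s2 by auto
  show e: "l1 = m2" "r1 = m2" "s2 = m2" "m2 = 0 \<or> m2 = 1"
    using lr m2 s2 01 by auto
  show n: "n1 = (2 * m2 - 1) * l2" using 9 unfolding e by algebra
  show "r2 = l2" using e(4) 9 10 unfolding e n by auto
qed

lemma classified_nil_extension_mult:
  assumes "semi_alternative_vec3 (nil_extension_mult n1 n2 l1 l2 m1 m2 r1 r2 s1 s2)"
  shows "classified (nil_extension_mult n1 n2 l1 l2 m1 m2 r1 r2 s1 s2)"
proof -
  note rel = nil_extension_mult_relations[OF assms]
  show ?thesis using rel(6)
  proof
    assume *: "m2 = 0"
    have "algebra_isomorphic (*s) (nil_extension_mult n1 n2 l1 l2 m1 m2 r1 r2 s1 s2) (*s) A11"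
      unfolding nil_extension_mult_def table_defs rel *
      \<comment> \<open>The first vector is an idempotent: \<open>- l2\<close> cancels the
        \<open>e3\<close> part of \<open>e1 e2\<close>, and the last coordinate is then determined
        by its square. The same holds for \<open>m2 = 1\<close>.\<close>
      by (rule isomorphic_tablesI[of 1 "-l2" "n2 - l2*l2" 0 1 0 0 0 1])
        (simp_all add: tables_simps algebra_simps)
    then show ?thesis by (rule classifiedI) (simp add: listed_def)
  next
    assume *: "m2 = 1"
    have "algebra_isomorphic (*s) (nil_extension_mult n1 n2 l1 l2 m1 m2 r1 r2 s1 s2) (*s) A10"
      unfolding nil_extension_mult_def table_defs rel *
      by (rule isomorphic_tablesI[of 1 "-l2" "l2*l2 - n2" 0 1 0 0 0 1])
        (simp_all add: tables_simps algebra_simps)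
    then show ?thesis by (rule classifiedI) (simp add: listed_def)
  qed
qed

section \<open>Tables whose kernel has a character of its own\<close>

definition character_extension_mult ::
  "complex \<Rightarrow> complex \<Rightarrow> complex \<Rightarrow> complex \<Rightarrow> complex \<Rightarrow> complex \<Rightarrow> complex \<Rightarrow> complex \<Rightarrow> complex \<Rightarrow>
    complex \<Rightarrow> complex \<Rightarrow> complex \<Rightarrow> complex \<Rightarrow> complex^3 \<Rightarrow> complex^3 \<Rightarrow> complex^3"
  where "character_extension_mult n1 n2 l2 m1 m2 r1 r2 s1 s2 b p q t = table_mult [
    ((1,1), e1 + n1 *s e2 + n2 *s e3), ((2,2), e2 + b *s e3), ((1,2), l2 *s e3),
    ((2,1), r1 *s e2 + r2 *s e3), ((1,3), m1 *s e2 + m2 *s e3), ((3,1), s1 *s e2 + s2 *s e3),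
    ((2,3), p *s e3), ((3,2), q *s e3), ((3,3), t *s e3)]"

text \<open>The obstruction to \<open>e3\<close> spanning an ideal is \<open>s1\<close>, the
  \<open>e2\<close> part of \<open>e3 e1\<close>. If it were nonzero, \<open>t = 0\<close> and
  \<open>p = 2\<close> would follow, whereas \<open>p\<close> is idempotent once
  \<open>t = 0\<close>. The other unwanted coefficients vanish with \<open>s1\<close>.\<close>

lemma classified_character_extension_mult:
  assumes "semi_alternative_vec3 (character_extension_mult n1 n2 l2 m1 m2 r1 r2 s1 s2 b p q t)"
  shows "classified (character_extension_mult n1 n2 l2 m1 m2 r1 r2 s1 s2 b p q t)"
proof -
  interpret semi_alternative_vec3 "character_extension_mult n1 n2 l2 m1 m2 r1 r2 s1 s2 b p q t" by fact
  note sm = character_extension_mult_def table_mult_simps algebra_simps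
  have 1: "t * s1 = 0"
    by (rule trans[OF _ cyclic_nth[of e3 e3 e1 2]]) (simp add: sm)
  have 2: "p * s1 - s1 - s1 = 0"
    by (rule trans[OF _ cyclic_nth[of e2 e3 e1 2]]) (simp add: sm)
  have 3: "q * s1 + m1 = 0"
    by (rule trans[OF _ cyclic_nth[of e3 e2 e1 2]]) (simp add: sm)
  have 4: "b * s1 - r1 = 0"
    by (rule trans[OF _ cyclic_nth[of e2 e2 e1 2]]) (simp add: sm)
  have 5: "n1 - l2 * m1 - l2 * s1 + r2 * m1 = 0"
    by (rule trans[OF _ cyclic_nth[of e1 e1 e2 2]]) (simp add: sm)
  have 6: "p + b * t - p * p = 0"
    by (rule trans[OF _ cyclic_nth[of e2 e2 e3 3]]) (simp add: sm)
  have "s1 = 0"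
  proof (rule ccontr)
    assume "s1 \<noteq> 0"
    then have "t = 0" "p = 2" using 1 2 by (auto simp: algebra_simps)
    then show False using 6 by simp
  qed
  then have z: "s1 = 0" "m1 = 0" "r1 = 0" "n1 = 0" using 3 4 5 by simp_all
  have "character_extension_mult n1 n2 l2 m1 m2 r1 r2 s1 s2 b p q t
    = two_characters_mult n2 b l2 r2 m2 s2 p q t"
    by (simp add: character_extension_mult_def two_characters_mult_def z)
  then show ?thesis using assms classified_two_characters_mult by simp
qed

section \<open>Algebras with a character\<close>

lemma semi_alternative_of_isomorphic:
  assumes "semi_alternative_vec3 m" and iso: "algebra_isomorphic (*s) m (*s) m'"
    and "complex_algebra (*s) m'"
  shows "semi_alternative_vec3 m'"
proof -
  interpret semi_alternative_vec3 m by fact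
  obtain f where f: "Vector_Spaces.linear (*s) (*s) f" "bij f" "\<And>x y. f (m x y) = m' (f x) (f y)"
    using iso unfolding algebra_isomorphic_def by blast
  interpret f: Vector_Spaces.linear "(*s)" "(*s)" f by (rule f)
  have "associator m' u v w = associator m' v w u" for u v w
  proof -
    obtain x y z where [simp]: "u = f x" "v = f y" "w = f z" using f(2) by (metis bij_pointE)
    show ?thesis
      using arg_cong[OF semi_alternative[of x y z], of f]
      by (simp add: associator_def f(3)[symmetric] f.diff)
  qed
  then show ?thesis
    by (intro semi_alternative_vec3.intro semi_alternative_algebra.intro assms(3)
        semi_alternative_algebra_axioms.intro)
qed

text \<open>With \<open>P = (a b; c d)\<close> and \<open>Q = (p q; r s)\<close>, the hypotheses say that \<open>P - P\<^sup>2 = Q\<^sup>2 - Q\<close> is the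
  commutator of the two matrices, hence it commutes with both of them.\<close>

lemma commuting_idempotents_2x2:
  fixes a b c d p q r s :: complex
  assumes "a - a * a - b * c = b * r - q * c" "b - a * b - b * d = a * q + b * s - p * b - q * d"
    "c - a * c - c * d = c * p + d * r - r * a - s * c" "d - d * d - b * c = c * q - r * b"
    and "p * p + q * r - p = b * r - q * c" "p * q + q * s - q = a * q + b * s - p * b - q * d"
    "p * r + r * s - r = c * p + d * r - r * a - s * c" "s * s + q * r - s = c * q - r * b"
  shows "b * r - q * c = 0" "a * q + b * s - p * b - q * d = 0" "c * p + d * r - r * a - s * c = 0"
proof -
  define x where "x = b * r - q * c"
  define y where "y = a * q + b * s - p * b - q * d"
  define z where "z = c * p + d * r - r * a - s * c"
  have P: "b * z = c * y" "(a - d) * y = 2 * x * b" "(a - d) * z = 2 * x * c"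
    using assms(1-4) unfolding x_def[symmetric] y_def[symmetric] z_def[symmetric]
    by (simp_all add: x_def) algebra+
  have Q: "q * z = r * y" "(p - s) * y = 2 * x * q" "(p - s) * z = 2 * x * r"
    using assms(5-8) unfolding x_def[symmetric] y_def[symmetric] z_def[symmetric]
    by (simp_all add: x_def) algebra+
  have y': "y = (a - d) * q - (p - s) * b" and z': "z = (p - s) * c - (a - d) * r"
    by (simp_all add: y_def z_def algebra_simps)
  \<comment> \<open>\<open>x, y, z\<close> are the entries of the traceless commutator. Inserting
    \<open>y'\<close> into one factor and rewriting by \<open>P\<close> and \<open>Q\<close> leaves,
    for instance, \<open>y * y = 2 x b q - 2 x q b = 0\<close>.\<close>
  have "2 * (x * x) = - (y * z)" "2 * (x * x) = y * z" "y * y = 0" "z * z = 0"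
    using P Q x_def y' z' by algebra+
  then have "x = 0 \<and> y = 0 \<and> z = 0" by auto
  then show "b * r - q * c = 0" "a * q + b * s - p * b - q * d = 0" "c * p + d * r - r * a - s * c = 0"
    by (simp_all add: x_def y_def z_def)
qed

locale semi_alternative_with_character = semi_alternative_vec3 m
  for m :: "complex^3 \<Rightarrow> complex^3 \<Rightarrow> complex^3" +
  fixes \<theta> :: "complex^3 \<Rightarrow> complex"
  assumes ch: "character \<theta>"
begin

lemma ch_add: "\<theta> (x + y) = \<theta> x + \<theta> y" and ch_scale: "\<theta> (c *s x) = c * \<theta> x"
  and ch_mul: "\<theta> (m x y) = \<theta> x * \<theta> y"
  using ch unfolding character_def by blast+

lemma ch_zero: "\<theta> 0 = 0" using ch_scale[of 0 0] by simp

lemma ch_minus: "\<theta> (- x) = - \<theta> x" using ch_scale[of "-1" x] by (simp add: vec.scale_minus_left)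

lemma ch_diff: "\<theta> (x - y) = \<theta> x - \<theta> y"
  using ch_add[of x "- y"] by (simp add: ch_minus)

lemmas ch_simps = ch_add ch_scale ch_mul ch_zero ch_minus ch_diff

definition adapted :: "complex^3 \<Rightarrow> complex^3 \<Rightarrow> complex^3 \<Rightarrow> bool" where
  "adapted e f g \<longleftrightarrow> indep3 e f g \<and> \<theta> e = 1 \<and> \<theta> f = 0 \<and> \<theta> g = 0"

lemma adapted_span:
  assumes "adapted e f g" "\<theta> v = 0"
  obtains b c where "v = b *s f + c *s g"
proof -
  obtain a b c where v: "v = a *s e + b *s f + c *s g"
    using assms(1) indep3_span unfolding adapted_def by metis
  then have "a = 0" using assms by (simp add: ch_simps adapted_def)
  with v that show ?thesis by simp
qed

lemma adapted_span1:
  assumes "adapted e f g" "\<theta> v = 1"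
  obtains b c where "v = e + b *s f + c *s g"
proof -
  obtain a b c where v: "v = a *s e + b *s f + c *s g"
    using assms(1) indep3_span unfolding adapted_def by metis
  then have "a = 1" using assms by (simp add: ch_simps adapted_def)
  with v that show ?thesis by simp
qed

lemma exists_adapted: obtains e f g where "adapted e f g"
proof -
  note main = that
  have ex: ?thesis if ind: "indep3 x y z" and nz: "\<theta> x \<noteq> 0" for x y z
  proof -
    have "indep3 ((1 / \<theta> x) *s x) (y - (\<theta> y / \<theta> x) *s x) (z - (\<theta> z / \<theta> x) *s x)"
      by (rule indep3_lincombI[OF ind, of _ "1 / \<theta> x" 0 0 _ "- \<theta> y / \<theta> x" 1 0 _ "- \<theta> z / \<theta> x" 0 1])
        (use nz in \<open>simp_all add: vec_eq_iff\<close>)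
    then show ?thesis
      using nz by (intro main[of "(1 / \<theta> x) *s x"]) (auto simp: adapted_def ch_simps)
  qed
  obtain v where "\<theta> v \<noteq> 0" using ch unfolding character_def by blast
  moreover obtain a b c where "v = a *s e1 + b *s e2 + c *s e3" by (rule indep3_span[OF indep3_axis])
  ultimately have "\<theta> e1 \<noteq> 0 \<or> \<theta> e2 \<noteq> 0 \<or> \<theta> e3 \<noteq> 0" by (auto simp: ch_simps)
  then show ?thesis
    using ex[OF indep3_axis] ex[OF indep3_rotate[OF indep3_axis]]
      ex[OF indep3_rotate[OF indep3_rotate[OF indep3_axis]]] by blast
qed

text \<open>The table inherits semi-alternativity through the isomorphism, so a family need only be
  classified under that assumption on its parameters.\<close>

lemma classified_by_table:
  assumes "adapted e f g" and M: "M = table_mult t" "semi_alternative_vec3 M \<Longrightarrow> classified M"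
    and p: "m e e = lincomb3 e f g (basis_product t 1 1)"
    "m e f = lincomb3 e f g (basis_product t 1 2)"
    "m e g = lincomb3 e f g (basis_product t 1 3)"
    "m f e = lincomb3 e f g (basis_product t 2 1)"
    "m f f = lincomb3 e f g (basis_product t 2 2)"
    "m f g = lincomb3 e f g (basis_product t 2 3)"
    "m g e = lincomb3 e f g (basis_product t 3 1)"
    "m g f = lincomb3 e f g (basis_product t 3 2)"
    "m g g = lincomb3 e f g (basis_product t 3 3)"
  shows "classified m"
proof -
  have iso: "algebra_isomorphic (*s) m (*s) (table_mult t)"
    using assms(1) by (intro isomorphic_table_multI[OF complex_algebra_axioms _ p])
      (simp add: adapted_def)
  then have "semi_alternative_vec3 (table_mult t)"
    using semi_alternative_of_isomorphic[OF semi_alternative_vec3_axioms]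
      complex_algebra_table_mult by blast
  with iso M show ?thesis using classified_iso by blast
qed

lemma classified_nil_extension:
  assumes ad: "adapted e f g" and p: "m f f = g" "m f g = 0" "m g f = 0" "m g g = 0"
  shows "classified m"
proof -
  have \<theta>: "\<theta> e = 1" "\<theta> f = 0" "\<theta> g = 0" using ad by (simp_all add: adapted_def)
  obtain n1 n2 where ee: "m e e = e + n1 *s f + n2 *s g"
    using adapted_span1[OF ad, of "m e e"] by (auto simp: ch_simps \<theta>)
  obtain l1 l2 where ef: "m e f = l1 *s f + l2 *s g"
    using adapted_span[OF ad, of "m e f"] by (auto simp: ch_simps \<theta>)
  obtain m1 m2 where eg: "m e g = m1 *s f + m2 *s g"
    using adapted_span[OF ad, of "m e g"] by (auto simp: ch_simps \<theta>)
  obtain r1 r2 where fe: "m f e = r1 *s f + r2 *s g"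
    using adapted_span[OF ad, of "m f e"] by (auto simp: ch_simps \<theta>)
  obtain s1 s2 where ge: "m g e = s1 *s f + s2 *s g"
    using adapted_span[OF ad, of "m g e"] by (auto simp: ch_simps \<theta>)
  show ?thesis
    by (rule classified_by_table[OF ad nil_extension_mult_def[of n1 n2 l1 l2 m1 m2 r1 r2 s1 s2]
          classified_nil_extension_mult])
      (simp_all add: table_entry_simps p ee ef eg fe ge)
qed

lemma classified_character_extension:
  assumes ad: "adapted e f g" and p: "m f f = f + b *s g" "m f g = p *s g" "m g f = q *s g"
    "m g g = t *s g"
  shows "classified m"
proof -
  have \<theta>: "\<theta> e = 1" "\<theta> f = 0" "\<theta> g = 0" using ad by (simp_all add: adapted_def)
  obtain l1 l2 where ef0: "m e f = l1 *s f + l2 *s g"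
    using adapted_span[OF ad, of "m e f"] by (auto simp: ch_simps \<theta>)
  \<comment> \<open>\<open>f f\<close> has \<open>f\<close> coordinate 1, so this shift removes the
    \<open>f\<close> part of \<open>e f\<close>; hence the table has no coefficient
    \<open>l1\<close>.\<close>
  define e' where "e' = e - l1 *s f"
  have "indep3 e' f g"
    by (rule indep3_lincombI[of e f g _ 1 "-l1" 0 _ 0 1 0 _ 0 0 1])
      (use ad in \<open>simp_all add: adapted_def e'_def vec_eq_iff\<close>)
  then have ad': "adapted e' f g" by (simp add: adapted_def \<theta> e'_def ch_simps)
  have ef: "m e' f = (l2 - l1 * b) *s g"
    by (simp add: e'_def mul_simps ef0 p vec_eq_iff algebra_simps)
  have \<theta>': "\<theta> e' = 1" using ad' by (simp add: adapted_def)
  obtain n1 n2 where ee: "m e' e' = e' + n1 *s f + n2 *s g"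
    using adapted_span1[OF ad', of "m e' e'"] by (auto simp: ch_simps \<theta>')
  obtain m1 m2 where eg: "m e' g = m1 *s f + m2 *s g"
    using adapted_span[OF ad', of "m e' g"] by (auto simp: ch_simps \<theta>)
  obtain r1 r2 where fe: "m f e' = r1 *s f + r2 *s g"
    using adapted_span[OF ad', of "m f e'"] by (auto simp: ch_simps \<theta>)
  obtain s1 s2 where ge: "m g e' = s1 *s f + s2 *s g"
    using adapted_span[OF ad', of "m g e'"] by (auto simp: ch_simps \<theta>)
  show ?thesis
    by (rule classified_by_table[OF ad' character_extension_mult_def[of n1 n2 "l2 - l1 * b" m1 m2 r1 r2 s1 s2 b p q t]
          classified_character_extension_mult])
      (simp_all add: table_entry_simps p ee ef eg fe ge)
qed

text \<open>On the kernel \<open>T\<close> is a projection of rank 0, 2 or 1. In the last case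
  \<open>u\<close> is one of \<open>T f, T g\<close>, and \<open>v\<close> one of
  \<open>f - T f, g - T g\<close>.\<close>

lemma idempotent_on_kernel:
  assumes ad: "adapted e f g" and T: "Vector_Spaces.linear (*s) (*s) T"
    and K: "\<theta> (T f) = 0" "\<theta> (T g) = 0" and id: "T (T f) = T f" "T (T g) = T g"
  obtains "T f = 0" "T g = 0" | "T f = f" "T g = g"
  | u v where "adapted e u v" "T u = u" "T v = 0"
proof -
  interpret T: Vector_Spaces.linear "(*s)" "(*s)" T by (rule T)
  note main = that(3)
  have ex: thesis if "T u = u" "T v = 0" "u \<noteq> 0" "v \<noteq> 0" "\<theta> u = 0" "\<theta> v = 0" for u v
  proof -
    have \<theta>: "\<theta> e = 1" using ad by (simp add: adapted_def)
    have "indep3 e u v"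
      unfolding indep3_def
    proof (intro allI impI)
      fix a b c
      assume 0: "a *s e + b *s u + c *s v = 0"
      have "a = \<theta> (a *s e + b *s u + c *s v)" by (simp add: ch_simps that \<theta>)
      then have a: "a = 0" by (simp add: 0 ch_zero)
      have "b *s u = T (b *s u + c *s v)" by (simp add: T.add T.scale that)
      then have "b = 0" using 0 a that by (simp add: T.zero)
      with 0 a that show "a = 0 \<and> b = 0 \<and> c = 0" by simp
    qed
    then show thesis using that \<theta> by (intro main[of u v]) (auto simp: adapted_def)
  qed
  have fg: "\<theta> f = 0" "\<theta> g = 0" using ad by (auto simp: adapted_def)
  have "T (f - T f) = 0" "T (g - T g) = 0" by (simp_all add: T.diff id)
  then show thesis
    using that(1,2) ex[of "T f" "f - T f"] ex[of "T f" "g - T g"] ex[of "T g" "f - T f"]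
      ex[of "T g" "g - T g"] id K fg
    by (metis ch_diff diff_zero eq_iff_diff_eq_0)
qed

end

section \<open>The three kinds of kernel\<close>

context semi_alternative_with_character
begin

lemma adapted_eqD:
  assumes "adapted e f g" "b *s f + c *s g = b' *s f + c' *s g"
  shows "b = b'" "c = c'"
  using indep3_eqD[of e f g 0 b c 0 b' c'] assms unfolding adapted_def by auto

lemma classified_peirce:
  assumes ad: "adapted e u v" and p: "m u u = 0" "m u v = 0" "m v u = 0" "m v v = 0"
    and q: "m e u = l1 *s u" "m u e = r1 *s u" "m e v = l2 *s v" "m v e = r2 *s v"
    and 01: "l1 \<in> {0, 1}" "r1 \<in> {0, 1}" "l2 \<in> {0, 1}" "r2 \<in> {0, 1}"
  shows "classified m"
proof -
  have \<theta>: "\<theta> e = 1" using ad by (simp add: adapted_def)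
  obtain n1 n2 where ee: "m e e = e + n1 *s u + n2 *s v"
    using adapted_span1[OF ad, of "m e e"] by (auto simp: ch_simps \<theta>)
  show ?thesis
    by (rule classified_by_table[OF ad peirce_mult_def[of n1 n2 l1 r1 l2 r2]
          classified_peirce_mult[OF 01]])
      (simp_all add: table_entry_simps p q ee)
qed

text \<open>The kernel multiplies to zero, so \<open>(ee)v = ev\<close> there. With left and right
  multiplication by \<open>e\<close> acting as \<open>P\<close> and \<open>Q\<close>, the
  associators of \<open>e, e, v\<close>, of \<open>e, v, e\<close> and of \<open>v, e, e\<close>
  become \<open>P - P^2\<close>, the commutator, and \<open>Q^2 - Q\<close>. Their equality makes
  both commuting idempotents, which are then diagonalised together.\<close>

lemma classified_null_kernel:
  assumes ad: "adapted e f g" and z: "m f f = 0" "m f g = 0" "m g f = 0" "m g g = 0"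
  shows "classified m"
proof -
  have \<theta>: "\<theta> e = 1" "\<theta> f = 0" "\<theta> g = 0" using ad by (simp_all add: adapted_def)
  have null: "m x y = 0" if xy: "\<theta> x = 0" "\<theta> y = 0" for x y
  proof -
    obtain b c b' c' where "x = b *s f + c *s g" "y = b' *s f + c' *s g"
      using adapted_span[OF ad] xy by metis
    then show ?thesis by (simp add: mul_simps z)
  qed
  obtain n1 n2 where ee: "m e e = e + n1 *s f + n2 *s g"
    using adapted_span1[OF ad, of "m e e"] by (auto simp: ch_simps \<theta>)
  obtain a b where ef: "m e f = a *s f + b *s g"
    using adapted_span[OF ad, of "m e f"] by (auto simp: ch_simps \<theta>)
  obtain c d where eg: "m e g = c *s f + d *s g"
    using adapted_span[OF ad, of "m e g"] by (auto simp: ch_simps \<theta>)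
  obtain p q where fe: "m f e = p *s f + q *s g"
    using adapted_span[OF ad, of "m f e"] by (auto simp: ch_simps \<theta>)
  obtain r s where ge: "m g e = r *s f + s *s g"
    using adapted_span[OF ad, of "m g e"] by (auto simp: ch_simps \<theta>)
  note sm = ee ef eg fe ge z mul_simps vec_eq_iff algebra_simps
  have f1: "(a - a * a - b * c) *s f + (b - a * b - b * d) *s g = m (m e e) f - m e (m e f)"
    and f2: "(b * r - q * c) *s f + (a * q + b * s - p * b - q * d) *s g
      = m (m e f) e - m e (m f e)"
    and f3: "(p * p + q * r - p) *s f + (p * q + q * s - q) *s g = m (m f e) e - m f (m e e)"
    and g1: "(c - a * c - c * d) *s f + (d - d * d - b * c) *s g = m (m e e) g - m e (m e g)"
    and g2: "(c * p + d * r - r * a - s * c) *s f + (c * q - r * b) *s g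
      = m (m e g) e - m e (m g e)"
    and g3: "(p * r + r * s - r) *s f + (s * s + q * r - s) *s g = m (m g e) e - m g (m e e)"
    by (simp_all add: sm)
  note E = adapted_eqD[OF ad trans[OF f1 trans[OF cyclic f2[symmetric]]]]
    adapted_eqD[OF ad trans[OF g1 trans[OF cyclic g2[symmetric]]]]
    adapted_eqD[OF ad trans[OF f3 trans[OF cyclic[symmetric] f2[symmetric]]]]
    adapted_eqD[OF ad trans[OF g3 trans[OF cyclic[symmetric] g2[symmetric]]]]
  note D = commuting_idempotents_2x2[OF E]
  have D': "c * q - r * b = 0" using D(1) by algebra
  have nfg: "m (m e e) f = m e f" "m (m e e) g = m e g" "m f (m e e) = m f e" "m g (m e e) = m g e"
    by (simp_all add: ee mul_simps z)
  have cf: "m (m e f) e = m e (m f e)" and cg: "m (m e g) e = m e (m g e)"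
    using f2 g2 by (simp_all add: D D')
  have idf: "m e (m e f) = m e f" "m (m f e) e = m f e"
    using cyclic[of e e f] cyclic[of e f e] cf nfg by simp_all
  have idg: "m e (m e g) = m e g" "m (m g e) e = m g e"
    using cyclic[of e e g] cyclic[of e g e] cg nfg by simp_all
  have K: "m e (m e v) = m e v" "m (m v e) e = m v e" "m (m e v) e = m e (m v e)"
    if v: "\<theta> v = 0" for v
  proof -
    obtain b c where "v = b *s f + c *s g" using adapted_span[OF ad v] .
    then show "m e (m e v) = m e v" "m (m v e) e = m v e" "m (m e v) e = m e (m v e)"
      by (simp_all add: mul_add_left mul_add_right mul_scale_left mul_scale_right idf idg cf cg)
  qed
  have \<theta>K: "\<theta> (m e v) = 0" "\<theta> (m v e) = 0" if "\<theta> v = 0" for v using that by (simp_all add: ch_simps)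
  \<comment> \<open>If left multiplication by \<open>e\<close> is scalar on the kernel, any
    eigenbasis of right multiplication is a joint one.\<close>
  have scalar: "classified m" if \<epsilon>: "\<epsilon> \<in> {0, 1}" and \<epsilon>fg: "m e f = \<epsilon> *s f" "m e g = \<epsilon> *s g" for \<epsilon>
  proof -
    have L: "m e v = \<epsilon> *s v" if v: "\<theta> v = 0" for v
    proof -
      obtain b c where v': "v = b *s f + c *s g" using adapted_span[OF ad v] .
      have "m e v = b *s (\<epsilon> *s f) + c *s (\<epsilon> *s g)"
        unfolding v' by (simp only: mul_add_right mul_scale_right \<epsilon>fg)
      also have "\<dots> = \<epsilon> *s v" by (simp add: v' vec_eq_iff algebra_simps)
      finally show ?thesis .
    qed
    show ?thesis
    proof (rule idempotent_on_kernel[OF ad, of "\<lambda>v. m v e"])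
      show "Vector_Spaces.linear (*s) (*s) (\<lambda>v. m v e)" by (rule linear_mul_left)
      assume "m f e = 0" "m g e = 0"
      then show ?thesis
        by (intro classified_peirce[OF ad z, of \<epsilon> 0 \<epsilon> 0]) (use \<epsilon> L \<theta> in auto)
    next
      assume "m f e = f" "m g e = g"
      then show ?thesis
        by (intro classified_peirce[OF ad z, of \<epsilon> 1 \<epsilon> 1]) (use \<epsilon> L \<theta> in auto)
    next
      fix u v assume uv: "adapted e u v" and "m u e = u" "m v e = 0"
      moreover have "\<theta> u = 0" "\<theta> v = 0" using uv by (auto simp: adapted_def)
      ultimately show ?thesis
        by (intro classified_peirce[OF uv, of \<epsilon> 1 \<epsilon> 0]) (use \<epsilon> L null in auto)
    qed (use \<theta>K K \<theta> in auto)
  qed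
  show ?thesis
  proof (rule idempotent_on_kernel[OF ad, of "m e"])
    show "Vector_Spaces.linear (*s) (*s) (m e)" by (rule linear_mul_right)
    assume "m e f = 0" "m e g = 0"
    then show ?thesis using scalar[of 0] by simp
  next
    assume "m e f = f" "m e g = g"
    then show ?thesis using scalar[of 1] by simp
  next
    fix u v assume uv: "adapted e u v" and e: "m e u = u" "m e v = 0"
    have \<theta>uv: "\<theta> u = 0" "\<theta> v = 0" using uv by (auto simp: adapted_def)
    have nz: "u \<noteq> 0" "v \<noteq> 0" using uv indep3_nz by (auto simp: adapted_def)
    \<comment> \<open>Right multiplication commutes with left multiplication by \<open>e\<close>, so
      it preserves the two eigenlines spanned by \<open>u\<close> and \<open>v\<close>.\<close>
    obtain \<alpha> \<beta> where ue: "m u e = \<alpha> *s u + \<beta> *s v"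
      using adapted_span[OF uv \<theta>K(2)[OF \<theta>uv(1)]] .
    have "\<alpha> *s u + \<beta> *s v = m (m e u) e" using ue e by simp
    also have "\<dots> = m e (m u e)" by (rule K(3)[OF \<theta>uv(1)])
    also have "\<dots> = \<alpha> *s u + 0 *s v" by (simp add: ue e mul_simps)
    finally have \<beta>: "\<beta> = 0" by (rule adapted_eqD[OF uv])
    have "(\<alpha> * \<alpha>) *s u = \<alpha> *s u" using K(2)[OF \<theta>uv(1)] by (simp add: ue \<beta> mul_simps)
    then have \<alpha>: "\<alpha> = 0 \<or> \<alpha> = 1" using nz by auto
    obtain \<gamma> \<delta> where ve: "m v e = \<gamma> *s u + \<delta> *s v"
      using adapted_span[OF uv \<theta>K(2)[OF \<theta>uv(2)]] .
    have "\<gamma> *s u = m e (m v e)" by (simp add: ve e mul_simps)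
    also have "\<dots> = 0" using K(3)[OF \<theta>uv(2)] by (simp add: e mul_simps)
    finally have \<gamma>: "\<gamma> = 0" using nz by simp
    have "(\<delta> * \<delta>) *s v = \<delta> *s v" using K(2)[OF \<theta>uv(2)] by (simp add: ve \<gamma> mul_simps)
    then have \<delta>: "\<delta> = 0 \<or> \<delta> = 1" using nz by auto
    show ?thesis
      by (rule classified_peirce[OF uv, of 1 \<alpha> 0 \<delta>])
        (use null \<theta>uv \<alpha> \<delta> in \<open>auto simp: e ue ve \<beta> \<gamma>\<close>)
  qed (use \<theta>K K \<theta> in auto)
qed

lemma classified_with_character: "classified m"
proof -
  obtain e f g where ad: "adapted e f g" by (rule exists_adapted)
  have \<theta>: "\<theta> e = 1" "\<theta> f = 0" "\<theta> g = 0" using ad by (simp_all add: adapted_def)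
  define pr where "pr x = x - \<theta> x *s e" for x
  \<comment> \<open>The product of the kernel, extended to the whole space by making
    \<open>e\<close> annihilate everything; this keeps semi-alternativity, and the dichotomy of
    dimension three can be used.\<close>
  define mk where "mk x y = m (pr x) (pr y)" for x y
  have pr0: "\<theta> (pr x) = 0" for x by (simp add: pr_def ch_simps \<theta>)
  have pr_id: "pr x = x" if "\<theta> x = 0" for x using that by (simp add: pr_def)
  have mk_eq: "mk x y = m x y" if "\<theta> x = 0" "\<theta> y = 0" for x y
    using that by (simp add: mk_def pr_id)
  have pr_lin: "pr (x + y) = pr x + pr y" "pr (c *s x) = c *s pr x" for x y c
    by (simp_all add: pr_def ch_simps vec_eq_iff algebra_simps)
  have "semi_alternative_vec3 mk"
  proof (intro semi_alternative_vec3.intro semi_alternative_algebra.intro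
      semi_alternative_algebra_axioms.intro complex_algebra.intro complex_algebra_axioms.intro
      vec.vector_space_axioms)
    fix x y z
    show "Vector_Spaces.linear (*s) (*s) (mk x)"
      by unfold_locales (simp_all add: mk_def pr_lin mul_simps)
    show "Vector_Spaces.linear (*s) (*s) (\<lambda>x. mk x y)"
      by unfold_locales (simp_all add: mk_def pr_lin mul_simps)
    have "associator mk x y z = associator m (pr x) (pr y) (pr z)" for x y z
      unfolding associator_def mk_def by (subst (1 2) pr_id) (simp_all add: ch_simps pr0)
    then show "associator mk x y z = associator mk y z x"
      using semi_alternative[of "pr x" "pr y" "pr z"] by simp
  qed
  then interpret k: semi_alternative_vec3 mk .
  interpret o: semi_alternative_vec3 "\<lambda>x y. mk y x" by (rule k.opposite)
  show ?thesis
  proof (rule k.character_or_nil)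
    fix \<psi> assume \<psi>: "k.character \<psi>"
    interpret c: semi_alternative_with_character mk \<psi>
      by (intro semi_alternative_with_character.intro k.semi_alternative_vec3_axioms
          semi_alternative_with_character_axioms.intro \<psi>)
    \<comment> \<open>Any character of \<open>mk\<close> vanishes on \<open>e\<close>, so it is
      nonzero somewhere on the kernel.\<close>
    have "mk e e = 0" by (simp add: mk_def pr_def \<theta> mul_simps)
    then have \<psi>e: "\<psi> e = 0" using c.ch_mul[of e e] by (simp add: c.ch_zero)
    have fin: "classified m" if ad: "adapted e f g" and nz: "\<psi> f \<noteq> 0" for f g
    proof -
      have \<theta>: "\<theta> e = 1" "\<theta> f = 0" "\<theta> g = 0" using ad by (simp_all add: adapted_def)
      define f' g' where "f' = (1 / \<psi> f) *s f" and "g' = g - (\<psi> g / \<psi> f) *s f"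
      have "indep3 e f' g'"
        by (rule indep3_lincombI[of e f g _ 1 0 0 _ 0 "1 / \<psi> f" 0 _ 0 "- \<psi> g / \<psi> f" 1])
          (use ad nz in \<open>simp_all add: adapted_def f'_def g'_def vec_eq_iff\<close>)
      then have ad': "adapted e f' g'" by (simp add: adapted_def \<theta> f'_def g'_def ch_simps)
      have \<theta>': "\<theta> f' = 0" "\<theta> g' = 0" using ad' by (simp_all add: adapted_def)
      have \<psi>': "\<psi> f' = 1" "\<psi> g' = 0" using nz by (simp_all add: f'_def g'_def c.ch_simps)
      have prod: "\<exists>t. m x y = (\<psi> x * \<psi> y) *s f' + t *s g'" if xy: "\<theta> x = 0" "\<theta> y = 0" for x y
      proof -
        obtain a t where *: "m x y = a *s f' + t *s g'"
          using adapted_span[OF ad', of "m x y"] xy by (auto simp: ch_simps)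
        have "a = \<psi> (m x y)" by (simp add: * c.ch_simps \<psi>')
        also have "\<dots> = \<psi> x * \<psi> y" using mk_eq[OF xy] c.ch_mul[of x y] by simp
        finally show ?thesis using * by blast
      qed
      show ?thesis
        using prod[OF \<theta>'(1) \<theta>'(1)] prod[OF \<theta>'(1) \<theta>'(2)] prod[OF \<theta>'(2) \<theta>'(1)]
          prod[OF \<theta>'(2) \<theta>'(2)] classified_character_extension[OF ad']
        by (auto simp: \<psi>')
    qed
    obtain v where v: "\<psi> v \<noteq> 0" using \<psi> unfolding k.character_def by blast
    obtain a b c where "v = a *s e + b *s f + c *s g"
      using ad indep3_span unfolding adapted_def by metis
    then have "\<psi> f \<noteq> 0 \<or> \<psi> g \<noteq> 0" using v \<psi>e by (auto simp: c.ch_simps)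
    moreover have "adapted e g f"
      using ad indep3_rotate indep3_swap unfolding adapted_def by blast
    ultimately show ?thesis using fin ad by blast
  next
    assume nil: "\<And>x y. mk x (mk x (mk x y)) = 0" "\<And>x y. mk (mk (mk y x) x) x = 0"
    show ?thesis
    proof (cases "\<forall>v. \<theta> v = 0 \<longrightarrow> m v v = 0")
      case True
      then have sq: "m f f = 0" "m g g = 0" "m (f + g) (f + g) = 0" by (simp_all add: \<theta> ch_add)
      then have ac: "m g f = - m f g"
        by (simp add: mul_add_left mul_add_right eq_neg_iff_add_eq_0)
      obtain \<alpha> \<beta> where fg: "m f g = \<alpha> *s f + \<beta> *s g"
        using adapted_span[OF ad, of "m f g"] by (auto simp: ch_simps \<theta>)
      \<comment> \<open>In the anticommutative plane \<open>fg\<close> is an eigenvector of left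
        multiplication by \<open>f\<close>, with eigenvalue \<beta>, and by \<open>g\<close>, with
        eigenvalue \<open>- \<alpha>\<close>; nilpotency makes both zero.\<close>
      have "m f g = 0"
      proof (rule ccontr)
        assume nz: "m f g \<noteq> 0"
        have \<theta>fg: "\<theta> (m f g) = 0" by (simp add: ch_mul \<theta>)
        have "mk f (m f g) = m f (\<alpha> *s f + \<beta> *s g)" using mk_eq[OF \<theta>(2) \<theta>fg] fg by simp
        then have "mk f (m f g) = \<beta> *s m f g" by (simp add: mul_simps sq)
        then have \<beta>: "\<beta> = 0" using k.left_eigenvalue_0[OF nil(1) _ nz] by blast
        have "mk g (m f g) = m g (\<alpha> *s f + \<beta> *s g)" using mk_eq[OF \<theta>(3) \<theta>fg] fg by simp
        then have "mk g (m f g) = (- \<alpha>) *s m f g" by (simp add: mul_simps sq ac)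
        then have "- \<alpha> = 0" using k.left_eigenvalue_0[OF nil(1) _ nz] by blast
        with \<beta> fg nz show False by simp
      qed
      then show ?thesis by (intro classified_null_kernel[OF ad]) (simp_all add: sq ac)
    next
      case False
      then obtain x where x: "\<theta> x = 0" "m x x \<noteq> 0" by blast
      define y where "y = m x x"
      have \<theta>y: "\<theta> y = 0" by (simp add: y_def ch_mul x)
      have y: "mk x x = y" "mk x y = m x y" "mk y x = m y x"
        by (simp_all add: y_def mk_eq x ch_mul)
      \<comment> \<open>Three vectors of the kernel are never independent, so the short case of the
        nilpotent analysis applies and \<open>x\<close>, \<open>y\<close> span the kernel.\<close>
      have dep: "\<not> indep3 x y z" if "\<theta> z = 0" for z
      proof
        assume "indep3 x y z"
        then obtain a b c where "e = a *s x + b *s y + c *s z" by (rule indep3_span)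
        then have "\<theta> e = 0" by (simp add: ch_simps x \<theta>y that)
        with \<theta> show False by simp
      qed
      have y0: "mk x x \<noteq> 0" using y x by (simp add: y_def)
      have dl: "\<not> indep3 x (mk x x) (mk x (mk x x))" and dr: "\<not> indep3 x (mk x x) (mk (mk x x) x)"
        by (simp_all add: y dep ch_mul x \<theta>y)
      have xy: "m x y = 0" "m y x = 0"
        using k.nil_short(1)[OF nil(1) y0 dl] o.nil_short(1)[OF nil(2) y0 dr] by (simp_all add: y)
      have yy: "m y y = 0" using cyclic[of x x y] by (simp add: y_def[symmetric] xy mul_simps)
      have "indep3 e x y"
        unfolding indep3_def
      proof (intro allI impI)
        fix a b c
        assume 0: "a *s e + b *s x + c *s y = 0"
        have "a = \<theta> (a *s e + b *s x + c *s y)" by (simp add: ch_simps \<theta> x \<theta>y)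
        then have a: "a = 0" by (simp add: 0 ch_zero)
        with 0 have "b = 0 \<and> c = 0" using k.nil_short(2)[OF nil(1) y0 dl] by (simp add: y)
        with a show "a = 0 \<and> b = 0 \<and> c = 0" by simp
      qed
      then have "adapted e x y" by (simp add: adapted_def \<theta> x \<theta>y)
      then show ?thesis using classified_nil_extension[OF _ y_def[symmetric] xy yy] by blast
    qed
  qed
qed

end

lemma (in semi_alternative_vec3) classified_nonzero:
  assumes "\<exists>x y. m x y \<noteq> 0"
  shows "classified m"
proof (rule character_or_nil)
  fix \<theta> assume "character \<theta>"
  then interpret semi_alternative_with_character m \<theta>
    by (intro semi_alternative_with_character.intro semi_alternative_vec3_axioms
        semi_alternative_with_character_axioms.intro)
  show "classified m" by (rule classified_with_character)
next
  assume "\<And>x y. m x (m x (m x y)) = 0" "\<And>x y. m (m (m y x) x) x = 0"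
  then show "classified m" using classified_nil assms by blast
qed

theorem theoremA2:
  fixes scale :: "complex \<Rightarrow> 'a::ab_group_add \<Rightarrow> 'a" and mul :: "'a \<Rightarrow> 'a \<Rightarrow> 'a"
  assumes "semi_alternative_algebra scale mul"
    and "vector_space.dim scale (UNIV :: 'a set) = 3"
    and "\<exists>x y. mul x y \<noteq> 0"
  shows "(\<exists>M \<in> {A01, A02, A03, A04, A05, A06, A07, A08, A09, A10, A11, A12,
              A13, A15, A16, A17, A18, A19, A20, A21, A22, A23, A24}.
            algebra_isomorphic scale mul vector_scalar_mult M) \<or>
         (\<exists>\<alpha>. \<alpha> \<noteq> 0 \<and> algebra_isomorphic scale mul vector_scalar_mult (A14 \<alpha>)) \<or>
         (\<exists>\<alpha>. algebra_isomorphic scale mul vector_scalar_mult (S01 \<alpha>)) \<or>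
         (\<exists>M \<in> {S02, S03, S04, S05, S06, S07, S08, S09, S10, S11, S12, S13}.
            algebra_isomorphic scale mul vector_scalar_mult M)"
proof -
  obtain m :: "complex^3 \<Rightarrow> complex^3 \<Rightarrow> complex^3"
    where m: "semi_alternative_algebra (*s) m" and iso: "algebra_isomorphic scale mul (*s) m"
    using isomorphic_vec3_algebra[OF assms(1,2)] .
  interpret semi_alternative_vec3 m by (rule semi_alternative_vec3.intro[OF m])
  obtain f where f: "Vector_Spaces.linear scale (*s) f" "bij f" "\<And>x y. f (mul x y) = m (f x) (f y)"
    using iso unfolding algebra_isomorphic_def by blast
  interpret f: Vector_Spaces.linear scale "(*s)" f by (rule f)
  obtain x y where "mul x y \<noteq> 0" using assms(3) by blast
  then have "m (f x) (f y) \<noteq> 0"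
    using f(2) by (metis f(3) f.zero bij_is_inj injD)
  then obtain M where M: "listed M" "algebra_isomorphic (*s) m (*s) M"
    using classified_nonzero unfolding classified_def by blast
  have "algebra_isomorphic scale mul (*s) M" by (rule algebra_isomorphic_trans[OF iso M(2)])
  with M(1) show ?thesis unfolding listed_def by (elim disjE exE conjE) blast+
qed

end
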